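(* Let $\{(R_n,B_n)\}_{n=1}^\infty$ be a sequence of admissible pairs in $\mathbb{R}^d$. Suppose that (i) $\lim_{n\to\infty}\|R_1^{-1}R_2^{-1}\cdots R_n^{-1}\|=0$, and that there is a cube $C=t_0+[0,1]^d$ for some $t_0\in\mathbb{R}^d$ such that (ii) for each $n\ge1$, $R_n^{-1}(C+b)\subseteq C$ for every $b\in B_n$, and (iii) there is an admissible pair $(R,B)$ which occurs infinitely many times in the sequence $\{(R_n,B_n)\}$ such that $R^{-1}(C+b_0)\subseteq\operatorname{int}(C)$ for some $b_0\in B$. Then the infinite convolution $$\mu=\delta_{R_1^{-1}B_1}*\delta_{(R_2R_1)^{-1}B_2}*\cdots*\delta_{(R_n\cdots R_1)^{-1}B_n}*\cdots$$ exists (i.e., the finite convolutions $\mu_n=\delta_{R_1^{-1}B_1}*\cdots*\delta_{(R_n\cdots R_1)^{-1}B_n}$ converge weakly) and is a spectral measure with a spectrum contained in $\mathbb{Z}^d$.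
   Context: A Borel probability measure $\mu$ on $\mathbb{R}^d$ is a spectral measure if there is a countable set $\Lambda\subseteq\mathbb{R}^d$ (a spectrum) such that $\{e^{2\pi i\lambda\cdot x}:\lambda\in\Lambda\}$ is an orthonormal basis of $L^2(\mu)$. For a finite $A\subseteq\mathbb{R}^d$, $\delta_A=\frac{1}{\#A}\sum_{a\in A}\delta_a$. A pair $(R,B)$ with $R$ a $d\times d$ expanding integer matrix and $B\subseteq\mathbb{Z}^d$ finite is an admissible pair if there is a finite $L\subseteq\mathbb{Z}^d$ with $\#L=\#B$ such that $\big[\frac{1}{\sqrt{\#B}}e^{-2\pi i(R^{-1}b)\cdot\ell}\big]_{b\in B,\ell\in L}$ is unitary. *)

theory Defs
  imports "HOL-Analysis.Analysis" "HOL-Probability.Probability"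
begin

definition int_lattice :: "(real ^ 'd) set" where
  "int_lattice = {x. \<forall>i. x $ i \<in> \<int>}"

definition int_matrix :: "real ^ 'd ^ 'd \<Rightarrow> bool" where
  "int_matrix A \<longleftrightarrow> (\<forall>i j. A $ i $ j \<in> \<int>)"

text \<open>Expanding: every (complex) eigenvalue has modulus strictly greater than 1,
  i.e. det(A - z I) is nonzero for every complex z with |z| <= 1.\<close>
definition expanding :: "real ^ 'd ^ 'd \<Rightarrow> bool" where
  "expanding A \<longleftrightarrow>
     (\<forall>z::complex. cmod z \<le> 1 \<longrightarrow>
        det ((\<chi> i j. complex_of_real (A $ i $ j) - (if i = j then z else 0)) :: complex ^ 'd ^ 'd) \<noteq> 0)"

definition adm_entry :: "real ^ 'd ^ 'd \<Rightarrow> (real ^ 'd) set \<Rightarrow> real ^ 'd \<Rightarrow> real ^ 'd \<Rightarrow> complex" where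
  "adm_entry R B b l =
     exp (- 2 * complex_of_real pi * \<i> * complex_of_real ((matrix_inv R *v b) \<bullet> l))
       / complex_of_real (sqrt (real (card B)))"

text \<open>Unitarity of the square matrix indexed by B x L: U U* = I and U* U = I.\<close>
definition admissible_pair :: "real ^ 'd ^ 'd \<Rightarrow> (real ^ 'd) set \<Rightarrow> bool" where
  "admissible_pair R B \<longleftrightarrow>
     expanding R \<and> int_matrix R \<and> finite B \<and> B \<noteq> {} \<and> B \<subseteq> int_lattice \<and>
     (\<exists>L. finite L \<and> L \<subseteq> int_lattice \<and> card L = card B \<and>
        (\<forall>b\<in>B. \<forall>b'\<in>B. (\<Sum>l\<in>L. adm_entry R B b l * cnj (adm_entry R B b' l))
                            = (if b = b' then 1 else 0)) \<and>
        (\<forall>l\<in>L. \<forall>l'\<in>L. (\<Sum>b\<in>B. cnj (adm_entry R B b l) * adm_entry R B b l')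
                            = (if l = l' then 1 else 0)))"

definition delta_set :: "('a::topological_space) set \<Rightarrow> 'a measure" where
  "delta_set A = distr (measure_pmf (pmf_of_set A)) borel (\<lambda>x. x)"

fun mat_prod_rev :: "(nat \<Rightarrow> real ^ 'd ^ 'd) \<Rightarrow> nat \<Rightarrow> real ^ 'd ^ 'd" where
  "mat_prod_rev R 0 = mat 1"
| "mat_prod_rev R (Suc n) = R (Suc n) ** mat_prod_rev R n"

fun inv_prod :: "(nat \<Rightarrow> real ^ 'd ^ 'd) \<Rightarrow> nat \<Rightarrow> real ^ 'd ^ 'd" where
  "inv_prod R 0 = mat 1"
| "inv_prod R (Suc n) = inv_prod R n ** matrix_inv (R (Suc n))"

fun conv_partial :: "(nat \<Rightarrow> real ^ 'd ^ 'd) \<Rightarrow> (nat \<Rightarrow> (real ^ 'd) set) \<Rightarrow> nat \<Rightarrow> (real ^ 'd) measure" where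
  "conv_partial R B 0 = return borel 0"
| "conv_partial R B (Suc n) =
     convolution (conv_partial R B n) (delta_set ((\<lambda>b. matrix_inv (mat_prod_rev R (Suc n)) *v b) ` B (Suc n)))"

definition weak_conv_to :: "(nat \<Rightarrow> ('a::euclidean_space) measure) \<Rightarrow> 'a measure \<Rightarrow> bool" where
  "weak_conv_to M \<mu> \<longleftrightarrow>
     (\<forall>f :: 'a \<Rightarrow> real. continuous_on UNIV f \<and> bounded (range f) \<longrightarrow>
        (\<lambda>n. \<integral>x. f x \<partial>M n) \<longlonglongrightarrow> (\<integral>x. f x \<partial>\<mu>))"

definition expo :: "'a::real_inner \<Rightarrow> 'a \<Rightarrow> complex" where
  "expo lam x = exp (2 * complex_of_real pi * \<i> * complex_of_real (lam \<bullet> x))"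

text \<open>Lambda is a spectrum of mu: {e_lambda : lambda in Lambda} is an orthonormal basis
  of L^2(mu) (orthonormal, and complete: only the zero element of L^2(mu) is orthogonal
  to all of them).\<close>
definition is_spectrum :: "('a::euclidean_space) measure \<Rightarrow> 'a set \<Rightarrow> bool" where
  "is_spectrum \<mu> \<Lambda> \<longleftrightarrow>
     countable \<Lambda> \<and>
     (\<forall>lam\<in>\<Lambda>. \<forall>lam'\<in>\<Lambda>. (\<integral>x. expo lam x * cnj (expo lam' x) \<partial>\<mu>) = (if lam = lam' then 1 else 0)) \<and>
     (\<forall>f :: 'a \<Rightarrow> complex. f \<in> borel_measurable \<mu> \<and> integrable \<mu> (\<lambda>x. (cmod (f x))\<^sup>2) \<and>
        (\<forall>lam\<in>\<Lambda>. (\<integral>x. f x * cnj (expo lam x) \<partial>\<mu>) = 0) \<longrightarrow> (AE x in \<mu>. f x = 0))"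

definition borel_prob :: "('a::topological_space) measure \<Rightarrow> bool" where
  "borel_prob \<mu> \<longleftrightarrow> prob_space \<mu> \<and> sets \<mu> = sets borel"

definition spectral_measure :: "('a::euclidean_space) measure \<Rightarrow> bool" where
  "spectral_measure \<mu> \<longleftrightarrow> borel_prob \<mu> \<and> (\<exists>\<Lambda>. is_spectrum \<mu> \<Lambda>)"

end

theory Submission
  imports Defs
begin

text \<open>
  Write \<open>^\<close> for the Fourier transform and \<open>M\<^sub>n = R\<^sub>n \<cdots> R\<^sub>1\<close>, and let \<open>\<nu>\<^sub>n\<close> be the infinite convolution built from the shifted sequence
  \<open>(R\<^sub>n\<^sub>+\<^sub>k, B\<^sub>n\<^sub>+\<^sub>k)\<close>. Realising \<open>\<mu>\<close> as the law of the random series of independent digits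
  \<open>\<Sum> M\<^sub>k\<^sup>-\<^sup>1 b\<^sub>k\<close>, which converges because its partial sums stay in nested images of the cube, one has
  \<open>\<mu>^(\<xi>) = \<mu>\<^sub>n^(\<xi>) \<nu>\<^sub>n^(M\<^sub>n\<^sup>-\<^sup>T \<xi>)\<close>, where \<open>\<mu>\<^sub>n^\<close> is \<open>M\<^sub>n\<^sup>T \<int>\<^sup>d\<close>-periodic.

  A finite \<open>\<Lambda> \<subseteq> \<int>\<^sup>d\<close> with \<open>\<Sum>\<^bsub>\<lambda>\<in>\<Lambda>\<^esub> |\<mu>\<^sub>n^(\<xi> + \<lambda>)|\<^sup>2 = 1\<close> for all \<open>\<xi>\<close> is extended from level \<open>n\<close> to a
  later level, each new element being free up to the period lattice. This freedom is used to keep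
  \<open>|\<nu>\<^sub>n^(M\<^sub>n\<^sup>-\<^sup>T \<lambda>)| \<ge> \<epsilon>\<close> along the levels where the recurring pair comes next; then domination gives
  \<open>\<Sum>\<^bsub>\<lambda>\<in>\<Lambda>\<^esub> |\<mu>^(\<xi> + \<lambda>)|\<^sup>2 = 1\<close> for the union, so every exponential, hence all of \<open>L\<^sup>2(\<mu>)\<close>, lies in the
  closed span of the \<open>e\<^sub>\<lambda>\<close>.

  That \<open>\<epsilon>\<close> exists uniformly comes from the recurring digit \<open>b\<^sub>0\<close>: it puts mass at least \<open>1 / #B\<close> of \<open>\<nu>\<^sub>n\<close>
  into a compact subset of the open cube, on which \<open>e\<^bsub>-x\<^esub>\<close> times a function vanishing on the boundary
  is periodic and thus approximable by trigonometric polynomials with integer frequencies. If all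
  \<open>\<nu>\<^sub>n^(x + k)\<close>, \<open>k \<in> \<int>\<^sup>d\<close>, were small, that mass would be small too.
\<close>

section \<open>Trigonometric polynomials\<close>

lemma expo_eq_cis: "expo a x = cis (2 * pi * (a \<bullet> x))"
  by (simp add: expo_def cis_conv_exp mult_ac)

lemma expo_zero [simp]: "expo 0 x = 1" "expo a 0 = 1"
  by (simp_all add: expo_def)

lemma expo_add_left: "expo (a + b) x = expo a x * expo b x"
  by (simp add: expo_eq_cis inner_add_left cis_mult distrib_left)

lemma expo_add_right: "expo a (x + y) = expo a x * expo a y"
  by (simp add: expo_eq_cis inner_add_right cis_mult distrib_left)

lemma expo_minus_left: "expo (- a) x = cnj (expo a x)"
  by (simp add: expo_eq_cis cis_cnj)

lemma expo_diff_left: "expo (a - b) x = expo a x * cnj (expo b x)"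
  using expo_add_left[of a "- b" x] by (simp add: expo_minus_left)

lemma norm_expo [simp]: "cmod (expo a x) = 1"
  by (simp add: expo_eq_cis)

lemma expo_sum_right: "expo a (\<Sum>i\<in>I. f i) = (\<Prod>i\<in>I. expo a (f i))"
  by (induction I rule: infinite_finite_induct) (simp_all add: expo_add_right)

lemma expo_eq_1: "a \<bullet> x \<in> \<int> \<Longrightarrow> expo a x = 1"
  by (simp add: expo_eq_cis cis_multiple_2pi)

lemma continuous_on_expo [continuous_intros]:
  "continuous_on A f \<Longrightarrow> continuous_on A g \<Longrightarrow> continuous_on A (\<lambda>x. expo (f x) (g x))"
  unfolding expo_def by (intro continuous_intros)

lemma borel_measurable_expo [measurable]:
  fixes a :: "'a::euclidean_space"
  shows "expo a \<in> borel_measurable borel"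
  by (intro borel_measurable_continuous_onI continuous_intros)

text \<open>Factoring out \<open>expo b x\<close> leaves the chord from 1 to
  \<open>expo (a - b) x\<close>, which is no longer than the arc; Cauchy-Schwarz then bounds the
  phase.\<close>

lemma norm_expo_diff_le: "cmod (expo a x - expo b x) \<le> 2 * pi * (norm (a - b) * norm x)"
proof -
  have "expo a x - expo b x = expo b x * (expo (a - b) x - 1)"
    using expo_add_left[of b "a - b" x] by (simp add: algebra_simps)
  then have "cmod (expo a x - expo b x) = cmod (cis (2 * pi * ((a - b) \<bullet> x)) - cis 0)"
    by (simp add: norm_mult expo_eq_cis[of "a - b"])
  also have "\<dots> \<le> \<bar>2 * pi * ((a - b) \<bullet> x)\<bar>"
    using dist_exp_i_1[of "2 * pi * ((a - b) \<bullet> x)"] abs_sin_x_le_abs_x[of "2 * pi * ((a - b) \<bullet> x) / 2"]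
    unfolding cis_conv_exp by simp
  also have "\<dots> = 2 * pi * \<bar>(a - b) \<bullet> x\<bar>"
    by (simp add: abs_mult)
  also have "\<dots> \<le> 2 * pi * (norm (a - b) * norm x)"
    by (intro mult_left_mono Cauchy_Schwarz_ineq2) auto
  finally show ?thesis .
qed

inductive_set trig_polys :: "'a::real_inner set \<Rightarrow> ('a \<Rightarrow> complex) set" for S where
  monomial: "k \<in> S \<Longrightarrow> (\<lambda>y. c * expo k y) \<in> trig_polys S"
| add: "p \<in> trig_polys S \<Longrightarrow> q \<in> trig_polys S \<Longrightarrow> (\<lambda>y. p y + q y) \<in> trig_polys S"

lemma trig_polys_cmult: "p \<in> trig_polys S \<Longrightarrow> (\<lambda>y. c * p y) \<in> trig_polys S"
proof (induction rule: trig_polys.induct)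
  case (monomial k d)
  then show ?case using trig_polys.monomial[of k S "c * d"] by (simp add: mult.assoc)
next
  case (add p q)
  then show ?case using trig_polys.add by (simp add: distrib_left)
qed

lemma trig_polys_mult:
  assumes S: "\<And>a b. a \<in> S \<Longrightarrow> b \<in> S \<Longrightarrow> a + b \<in> S"
    and p: "p \<in> trig_polys S" and q: "q \<in> trig_polys S"
  shows "(\<lambda>y. p y * q y) \<in> trig_polys S"
proof -
  have mono: "(\<lambda>y. (c * expo k y) * q y) \<in> trig_polys S" if k: "k \<in> S" for c k
    using q
  proof (induction rule: trig_polys.induct)
    case (monomial l d)
    then show ?case
      using trig_polys.monomial[OF S[OF k monomial], of "c * d"]
      by (simp add: expo_add_left mult_ac)
  next
    case (add p q)
    then show ?case using trig_polys.add by (simp add: distrib_left)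
  qed
  from p show ?thesis
  proof (induction rule: trig_polys.induct)
    case (monomial k c)
    then show ?case by (rule mono)
  next
    case (add p q)
    then show ?case using trig_polys.add by (simp add: distrib_right)
  qed
qed

lemma continuous_on_trig_poly: "p \<in> trig_polys S \<Longrightarrow> continuous_on A p"
  by (induction rule: trig_polys.induct) (intro continuous_intros | assumption)+

section \<open>Uniform approximation by trigonometric polynomials\<close>

text \<open>A continuous map from a compact to a Hausdorff space is closed, so \<open>E\<close> is a
  quotient map onto its image: the preimage of a closed set under \<open>H\<close> is the
  \<open>E\<close>-image of a compact set.\<close>

lemma continuous_on_factor_compact:
  fixes E :: "'a::t2_space \<Rightarrow> 'b::t2_space" and u :: "'a \<Rightarrow> 'c::topological_space"
  assumes C: "compact C" and E: "continuous_on C E" and u: "continuous_on C u"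
    and fib: "\<And>y y'. y \<in> C \<Longrightarrow> y' \<in> C \<Longrightarrow> E y = E y' \<Longrightarrow> u y = u y'"
  obtains H where "continuous_on (E ` C) H" "\<And>y. y \<in> C \<Longrightarrow> H (E y) = u y"
proof
  define H where "H = u \<circ> inv_into C E"
  show HE: "H (E y) = u y" if "y \<in> C" for y
  proof -
    have "E y \<in> E ` C"
      using that by simp
    then show ?thesis
      unfolding H_def o_def by (intro fib that inv_into_into f_inv_into_f)
  qed
  show "continuous_on (E ` C) H"
    unfolding continuous_on_closed_invariant
  proof (intro allI impI)
    fix F :: "'c set" assume "closed F"
    have "closedin (top_of_set C) (C \<inter> u -` F)"
      by (rule continuous_closedin_preimage[OF u \<open>closed F\<close>])
    then have "compact (C \<inter> u -` F)"
      using C closedin_compact by blast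
    then have "compact (E ` (C \<inter> u -` F))"
      by (intro compact_continuous_image continuous_on_subset[OF E]) auto
    then have "closed (E ` (C \<inter> u -` F))"
      by (rule compact_imp_closed)
    moreover have "E ` (C \<inter> u -` F) \<inter> E ` C = H -` F \<inter> E ` C"
      using HE by auto
    ultimately show "\<exists>A. closed A \<and> A \<inter> E ` C = H -` F \<inter> E ` C"
      by blast
  qed
qed

text \<open>The map \<open>E\<close> accounts for the periodicity of the frequencies in \<open>S\<close>: with integer
  frequencies only functions on the torus can be approximated.\<close>

lemma trig_poly_approx_real:
  fixes E :: "'a::real_inner \<Rightarrow> 'b::t2_space" and u :: "'a \<Rightarrow> real"
  assumes S0: "0 \<in> S" and S: "\<And>a b. a \<in> S \<Longrightarrow> b \<in> S \<Longrightarrow> a + b \<in> S"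
    and C: "compact C" and E: "continuous_on C E" and u: "continuous_on C u"
    and fib: "\<And>y y'. y \<in> C \<Longrightarrow> y' \<in> C \<Longrightarrow> E y = E y' \<Longrightarrow> u y = u y'"
    and sep: "\<And>y y'. y \<in> C \<Longrightarrow> y' \<in> C \<Longrightarrow> E y \<noteq> E y' \<Longrightarrow>
      \<exists>H::'b \<Rightarrow> real. continuous_on (E ` C) H \<and> (\<lambda>y. complex_of_real (H (E y))) \<in> trig_polys S \<and>
        H (E y) \<noteq> H (E y')"
    and e: "e > 0"
  shows "\<exists>p\<in>trig_polys S. \<forall>y\<in>C. cmod (complex_of_real (u y) - p y) < e"
proof -
  obtain H where H: "continuous_on (E ` C) H" and HE: "\<And>y. y \<in> C \<Longrightarrow> H (E y) = u y"
    using continuous_on_factor_compact[OF C E u fib] by blast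
  \<comment> \<open>Stone-Weierstrass is applied on the image of \<open>C\<close> under
    \<open>E\<close>, to the algebra of real functions whose pullback along \<open>E\<close> is a
    trigonometric polynomial.\<close>
  define P where "P = (\<lambda>h::'b \<Rightarrow> real. continuous_on (E ` C) h \<and>
    (\<lambda>y. complex_of_real (h (E y))) \<in> trig_polys S)"
  have "\<exists>g. P g \<and> (\<forall>x\<in>E ` C. \<bar>H x - g x\<bar> < e)"
  proof (rule Stone_Weierstrass_HOL)
    show "compact (E ` C)"
      by (rule compact_continuous_image[OF E C])
    show "P (\<lambda>x. c)" for c
      using trig_polys.monomial[OF S0, of "complex_of_real c"] by (simp add: P_def)
    show "P (\<lambda>x. f x + g x)" if "P f \<and> P g" for f g
      using that by (auto simp: P_def intro!: continuous_intros trig_polys.add)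
    show "P (\<lambda>x. f x * g x)" if "P f \<and> P g" for f g
      using that by (auto simp: P_def intro!: continuous_intros trig_polys_mult S)
    show "\<exists>f. P f \<and> f x \<noteq> f y" if "x \<in> E ` C \<and> y \<in> E ` C \<and> x \<noteq> y" for x y
      using that sep by (auto simp: P_def)
  qed (use H e in \<open>auto simp: P_def\<close>)
  then obtain g where g: "P g" "\<And>x. x \<in> E ` C \<Longrightarrow> \<bar>H x - g x\<bar> < e"
    by blast
  have "cmod (complex_of_real (u y) - complex_of_real (g (E y))) < e" if "y \<in> C" for y
    using g(2)[of "E y"] that HE[OF that]
    by (metis image_eqI norm_of_real of_real_diff)
  with g(1) show ?thesis
    by (auto simp: P_def intro!: bexI[of _ "\<lambda>y. complex_of_real (g (E y))"])
qed

lemma trig_poly_approx: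
  fixes E :: "'a::real_inner \<Rightarrow> 'b::t2_space" and u :: "'a \<Rightarrow> complex"
  assumes S0: "0 \<in> S" and S: "\<And>a b. a \<in> S \<Longrightarrow> b \<in> S \<Longrightarrow> a + b \<in> S"
    and C: "compact C" and E: "continuous_on C E" and u: "continuous_on C u"
    and fib: "\<And>y y'. y \<in> C \<Longrightarrow> y' \<in> C \<Longrightarrow> E y = E y' \<Longrightarrow> u y = u y'"
    and sep: "\<And>y y'. y \<in> C \<Longrightarrow> y' \<in> C \<Longrightarrow> E y \<noteq> E y' \<Longrightarrow>
      \<exists>H::'b \<Rightarrow> real. continuous_on (E ` C) H \<and> (\<lambda>y. complex_of_real (H (E y))) \<in> trig_polys S \<and>
        H (E y) \<noteq> H (E y')"
    and e: "e > 0"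
  shows "\<exists>p\<in>trig_polys S. \<forall>y\<in>C. cmod (u y - p y) < e"
proof -
  have "\<exists>p\<in>trig_polys S. \<forall>y\<in>C. cmod (complex_of_real (Re (u y)) - p y) < e / 2"
  proof (rule trig_poly_approx_real[OF S0 S C E _ _ sep])
    show "continuous_on C (\<lambda>y. Re (u y))"
      using u by (rule continuous_on_Re)
    show "Re (u y) = Re (u y')" if "y \<in> C" "y' \<in> C" "E y = E y'" for y y'
      using fib[OF that] by simp
  qed (use e in simp_all)
  moreover have "\<exists>p\<in>trig_polys S. \<forall>y\<in>C. cmod (complex_of_real (Im (u y)) - p y) < e / 2"
  proof (rule trig_poly_approx_real[OF S0 S C E _ _ sep])
    show "continuous_on C (\<lambda>y. Im (u y))"
      using u by (rule continuous_on_Im)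
    show "Im (u y) = Im (u y')" if "y \<in> C" "y' \<in> C" "E y = E y'" for y y'
      using fib[OF that] by simp
  qed (use e in simp_all)
  ultimately obtain p q where p: "p \<in> trig_polys S" "\<And>y. y \<in> C \<Longrightarrow> cmod (complex_of_real (Re (u y)) - p y) < e / 2"
    and q: "q \<in> trig_polys S" "\<And>y. y \<in> C \<Longrightarrow> cmod (complex_of_real (Im (u y)) - q y) < e / 2"
    by blast
  have "cmod (u y - (p y + \<i> * q y)) < e" if "y \<in> C" for y
  proof -
    have "u y - (p y + \<i> * q y) = (complex_of_real (Re (u y)) - p y) + \<i> * (complex_of_real (Im (u y)) - q y)"
      using complex_eq[of "u y"] by (simp add: algebra_simps)
    also have "cmod \<dots> \<le> cmod (complex_of_real (Re (u y)) - p y) + cmod (complex_of_real (Im (u y)) - q y)"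
      by (rule order_trans[OF norm_triangle_ineq]) (simp add: norm_mult)
    also have "\<dots> < e"
      using p(2)[OF that] q(2)[OF that] by simp
    finally show ?thesis .
  qed
  then show ?thesis
    by (intro bexI[of _ "\<lambda>y. p y + \<i> * q y"] trig_polys.add p(1) trig_polys_cmult q(1)) auto
qed

text \<open>With all real frequencies the exponentials separate the points of the space itself, so
  \<open>E\<close> can be the identity.\<close>

lemma trig_poly_approx_compact:
  fixes u :: "'a::real_inner \<Rightarrow> complex"
  assumes C: "compact C" and u: "continuous_on C u" and e: "e > 0"
  shows "\<exists>p\<in>trig_polys UNIV. \<forall>y\<in>C. cmod (u y - p y) < e"
proof (rule trig_poly_approx[where E = "\<lambda>y. y"])
  fix y y' :: 'a assume ne: "y \<noteq> y'"
  \<comment> \<open>The scaling puts \<open>y\<close> and \<open>y'\<close> a quarter period apart,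
    so that the sine \<open>H\<close> is 1 at \<open>y\<close> and 0 at \<open>y'\<close>.\<close>
  define v where "v = (1 / (4 * (norm (y - y'))\<^sup>2)) *\<^sub>R (y - y')"
  have v: "v \<bullet> (y - y') = 1 / 4"
    using ne by (simp add: v_def power2_norm_eq_inner)
  define H where "H z = Im (expo v (z - y'))" for z
  have Hz: "complex_of_real (H z) = (- \<i> / 2 * expo v (- y')) * expo v z + (\<i> / 2 * expo (- v) (- y')) * expo (- v) z" for z
  proof -
    have "complex_of_real (H z) = (- \<i> / 2) * expo v (z - y') + (\<i> / 2) * expo (- v) (z - y')"
      by (simp add: H_def expo_minus_left complex_eq_iff)
    then show ?thesis
      using expo_add_right[of v z "- y'"] expo_add_right[of "- v" z "- y'"] by (simp add: mult_ac)
  qed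
  have "(\<lambda>z. complex_of_real (H z)) \<in> trig_polys UNIV"
    unfolding Hz by (intro trig_polys.intros UNIV_I)
  moreover have "H y \<noteq> H y'"
    unfolding H_def expo_eq_cis v by simp
  moreover have "continuous_on C H"
    unfolding H_def by (intro continuous_intros)
  ultimately show "\<exists>H. continuous_on ((\<lambda>y. y) ` C) H \<and> (\<lambda>y. complex_of_real (H y)) \<in> trig_polys UNIV \<and> H y \<noteq> H y'"
    by auto
qed (use assms in auto)

section \<open>The integer lattice and functions on the torus\<close>

lemma axis_in_int_lattice: "axis j 1 \<in> int_lattice" "- axis j 1 \<in> int_lattice"
  by (auto simp: int_lattice_def axis_def)

lemma int_lattice_closed:
  "0 \<in> int_lattice" "a \<in> int_lattice \<Longrightarrow> b \<in> int_lattice \<Longrightarrow> a + b \<in> int_lattice"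
  "a \<in> int_lattice \<Longrightarrow> b \<in> int_lattice \<Longrightarrow> a - b \<in> int_lattice"
  by (auto simp: int_lattice_def)

lemma int_lattice_inner: "a \<in> int_lattice \<Longrightarrow> b \<in> int_lattice \<Longrightarrow> a \<bullet> b \<in> \<int>"
  by (auto simp: int_lattice_def inner_vec_def)

lemma One_nth: "(One :: real ^ 'd) $ i = 1"
proof -
  have "(One :: real ^ 'd) \<bullet> axis i 1 = 1"
    by (simp add: inner_sum_left_Basis axis_in_Basis_iff)
  then show ?thesis
    by (simp add: inner_axis)
qed

lemma mem_unit_cube:
  fixes t :: "real ^ 'd"
  shows "y \<in> cbox t (t + One) \<longleftrightarrow> (\<forall>j. t $ j \<le> y $ j \<and> y $ j \<le> t $ j + 1)"
  by (simp add: mem_box_cart One_nth del: sum_component)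

text \<open>The coordinate exponentials map the cube onto the torus and identify only points on its
  faces; since \<open>u\<close> vanishes there, it descends to the torus.\<close>

lemma trig_poly_approx_torus:
  fixes u :: "real ^ 'd \<Rightarrow> complex" and t :: "real ^ 'd"
  assumes u: "continuous_on (cbox t (t + One)) u"
    and bd: "\<And>y j. y \<in> cbox t (t + One) \<Longrightarrow> y $ j = t $ j \<or> y $ j = t $ j + 1 \<Longrightarrow> u y = 0"
    and e: "e > 0"
  shows "\<exists>p\<in>trig_polys int_lattice. \<forall>y\<in>cbox t (t + One). cmod (u y - p y) < e"
proof (rule trig_poly_approx[where E = "\<lambda>y. (\<chi> j. expo (axis j 1) y) :: complex ^ 'd"])
  fix y y' :: "real ^ 'd"
  assume y: "y \<in> cbox t (t + One)" and y': "y' \<in> cbox t (t + One)"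
  have rng: "t $ j \<le> y $ j \<and> y $ j \<le> t $ j + 1 \<and> t $ j \<le> y' $ j \<and> y' $ j \<le> t $ j + 1" for j
    using y y' by (simp add: mem_unit_cube)
  show "u y = u y'" if eq: "(\<chi> j. expo (axis j 1) y) = (\<chi> j. expo (axis j 1) y')"
  proof (cases "y = y'")
    case False
    then obtain j where j: "y $ j \<noteq> y' $ j"
      by (auto simp: vec_eq_iff)
    have "expo (axis j 1) y = expo (axis j 1) y'"
      using eq by (simp add: vec_eq_iff)
    then have "sin (2 * pi * y $ j) = sin (2 * pi * y' $ j) \<and> cos (2 * pi * y $ j) = cos (2 * pi * y' $ j)"
      by (simp add: expo_eq_cis inner_axis' complex_eq_iff)
    then obtain n :: int where "2 * pi * y $ j = 2 * pi * y' $ j + 2 * pi * of_int n"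
      unfolding sin_cos_eq_iff by blast
    then have "2 * pi * y $ j = 2 * pi * (y' $ j + of_int n)"
      by (simp add: distrib_left)
    then have n: "y $ j = y' $ j + of_int n"
      by simp
    \<comment> \<open>The two coordinates differ by a nonzero integer and lie in an interval of
      length 1, hence are its endpoints; both points are then on faces of the cube.\<close>
    with rng[of j] j have "n = 1 \<or> n = -1"
      by (smt (verit) of_int_0 of_int_1 of_int_le_iff of_int_less_iff of_int_minus)
    with n rng[of j] have "y $ j = t $ j \<and> y' $ j = t $ j + 1 \<or> y' $ j = t $ j \<and> y $ j = t $ j + 1"
      by auto
    then show ?thesis
      using bd[OF y, of j] bd[OF y', of j] by auto
  qed simp
  assume "(\<chi> j. expo (axis j 1) y) \<noteq> (\<chi> j. expo (axis j 1) y')"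
  then obtain j where j: "expo (axis j 1) y \<noteq> expo (axis j 1) y'"
    by (auto simp: vec_eq_iff)
  define k :: "real ^ 'd" where "k = axis j 1"
  have k: "k \<in> int_lattice" "- k \<in> int_lattice"
    by (simp_all add: k_def axis_in_int_lattice)
  have re: "complex_of_real (Re (expo k z)) = 1 / 2 * expo k z + 1 / 2 * expo (- k) z" for z
    by (simp add: expo_minus_left complex_eq_iff)
  have im: "complex_of_real (Im (expo k z)) = - \<i> / 2 * expo k z + \<i> / 2 * expo (- k) z" for z
    by (simp add: expo_minus_left complex_eq_iff)
  let ?X = "(\<lambda>y. (\<chi> j. expo (axis j 1) y) :: complex ^ 'd) ` cbox t (t + One)"
  \<comment> \<open>A coordinate exponential that separates the points does so by its real or its
    imaginary part, and both are combinations of the frequencies \<open>k\<close> and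
    \<open>- k\<close>.\<close>
  consider "Re (expo k y) \<noteq> Re (expo k y')" | "Im (expo k y) \<noteq> Im (expo k y')"
    using j by (auto simp: k_def complex_eq_iff)
  then show "\<exists>H. continuous_on ?X H \<and>
      (\<lambda>y. complex_of_real (H (\<chi> j. expo (axis j 1) y))) \<in> trig_polys int_lattice \<and>
      H (\<chi> j. expo (axis j 1) y) \<noteq> H (\<chi> j. expo (axis j 1) y')"
  proof cases
    case 1
    have "(\<lambda>z. complex_of_real (Re (expo k z))) \<in> trig_polys int_lattice"
      unfolding re by (intro trig_polys.intros k)
    then show ?thesis
      using 1 by (intro exI[of _ "\<lambda>w. Re (w $ j)"]) (auto simp: k_def intro!: continuous_intros)
  next
    case 2
    have "(\<lambda>z. complex_of_real (Im (expo k z))) \<in> trig_polys int_lattice"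
      unfolding im by (intro trig_polys.intros k)
    then show ?thesis
      using 2 by (intro exI[of _ "\<lambda>w. Im (w $ j)"]) (auto simp: k_def intro!: continuous_intros)
  qed
qed (use u e in \<open>auto intro!: int_lattice_closed continuous_intros\<close>)

section \<open>Fourier transforms of measures on the unit cube\<close>

text \<open>The kernel carries a plus sign, so this is the usual transform at
  \<open>- \<xi>\<close>; by conjugation symmetry the modulus is the same.\<close>

definition fourier :: "'a::euclidean_space measure \<Rightarrow> 'a \<Rightarrow> complex" where
  "fourier M \<xi> = (\<integral>x. expo \<xi> x \<partial>M)"

lemma borel_prob_measurable:
  assumes "borel_prob M" "f \<in> borel_measurable borel"
  shows "f \<in> borel_measurable M"
  using assms measurable_cong_sets by (auto simp: borel_prob_def)

lemma integrable_mult_bounded: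
  fixes f g :: "'a::euclidean_space \<Rightarrow> complex"
  assumes f: "integrable M f" and g: "g \<in> borel_measurable M" and bd: "\<And>x. cmod (g x) \<le> W"
  shows "integrable M (\<lambda>x. f x * g x)"
proof (rule Bochner_Integration.integrable_bound)
  show "integrable M (\<lambda>x. W * norm (f x))"
    using f by auto
  have "cmod (f x * g x) \<le> norm (W * norm (f x))" for x
  proof -
    have "cmod (f x * g x) \<le> cmod (f x) * W"
      unfolding norm_mult by (intro mult_left_mono bd) auto
    then show ?thesis
      by (simp add: mult.commute abs_mult) (smt (verit) mult_right_mono norm_ge_zero)
  qed
  then show "AE x in M. cmod (f x * g x) \<le> norm (W * norm (f x))"
    by simp
qed (use f g in measurable)

lemma integrable_bounded_borel:
  fixes g :: "'a::euclidean_space \<Rightarrow> complex"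
  assumes M: "borel_prob M" and g: "g \<in> borel_measurable borel" and bd: "\<And>x. cmod (g x) \<le> W"
  shows "integrable M g"
proof -
  interpret prob_space M
    using M by (simp add: borel_prob_def)
  show ?thesis
    using bd by (intro integrable_const_bound[of _ W] borel_prob_measurable[OF M g]) auto
qed

lemma integrable_expo:
  fixes \<xi> :: "'a::euclidean_space"
  shows "borel_prob M \<Longrightarrow> integrable M (expo \<xi>)"
  by (rule integrable_bounded_borel[where W = 1]) auto

lemma fourier_0: "borel_prob M \<Longrightarrow> fourier M 0 = 1"
  by (simp add: fourier_def borel_prob_def prob_space.prob_space)

lemma norm_integral_diff_le:
  fixes f g :: "'a::euclidean_space \<Rightarrow> complex"
  assumes M: "borel_prob M" and f: "integrable M f" and g: "integrable M g"
    and le: "AE x in M. cmod (f x - g x) \<le> e"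
  shows "cmod ((\<integral>x. f x \<partial>M) - (\<integral>x. g x \<partial>M)) \<le> e"
proof -
  interpret prob_space M
    using M by (simp add: borel_prob_def)
  have "cmod ((\<integral>x. f x \<partial>M) - (\<integral>x. g x \<partial>M)) = cmod (\<integral>x. f x - g x \<partial>M)"
    using f g by simp
  also have "\<dots> \<le> (\<integral>x. cmod (f x - g x) \<partial>M)"
    by (rule integral_norm_bound)
  also have "\<dots> \<le> (\<integral>x. e \<partial>M)"
    using f g le by (intro integral_mono_AE) auto
  finally show ?thesis
    by (simp add: prob_space)
qed

text \<open>The constant depends only on the radius of a ball that carries \<open>M\<close>, so that
  one constant will serve all tails of the convolution.\<close>

lemma fourier_Lipschitz:
  assumes M: "borel_prob M" and bd: "AE x in M. norm x \<le> \<rho>"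
  shows "cmod (fourier M a - fourier M b) \<le> 2 * pi * \<rho> * norm (a - b)"
  unfolding fourier_def
proof (rule norm_integral_diff_le[OF M])
  show "AE x in M. cmod (expo a x - expo b x) \<le> 2 * pi * \<rho> * norm (a - b)"
    using bd
  proof eventually_elim
    case (elim x)
    have "cmod (expo a x - expo b x) \<le> 2 * pi * (norm (a - b) * norm x)"
      by (rule norm_expo_diff_le)
    also have "\<dots> \<le> 2 * pi * (norm (a - b) * \<rho>)"
      using elim by (intro mult_left_mono) auto
    also have "\<dots> = 2 * pi * \<rho> * norm (a - b)"
      by simp
    finally show ?case .
  qed
qed (simp_all add: M integrable_expo)

lemma trig_poly_bounded: "p \<in> trig_polys S \<Longrightarrow> \<exists>W. \<forall>y. cmod (p y) \<le> W"
proof (induction rule: trig_polys.induct)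
  case (monomial k c)
  show ?case by (intro exI[of _ "cmod c"]) (simp add: norm_mult)
next
  case (add p q)
  then obtain W V where "\<And>y. cmod (p y) \<le> W" "\<And>y. cmod (q y) \<le> V"
    by blast
  then show ?case
    by (intro exI[of _ "W + V"] allI norm_triangle_mono)
qed

lemma trig_poly_measurable:
  fixes p :: "'a::euclidean_space \<Rightarrow> complex"
  shows "p \<in> trig_polys S \<Longrightarrow> p \<in> borel_measurable borel"
  by (intro borel_measurable_continuous_onI continuous_on_trig_poly)

text \<open>The integral is a combination of values \<open>fourier M (x + k)\<close>, and
  \<open>W\<close> is the sum of the moduli of its coefficients. The point is that \<open>W\<close>
  is chosen before \<open>M\<close>, \<open>x\<close> and \<open>e\<close>.\<close>

lemma trig_poly_integral_bound:
  fixes p :: "'a::euclidean_space \<Rightarrow> complex"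
  assumes "p \<in> trig_polys S"
  shows "\<exists>W\<ge>0. \<forall>M x e. borel_prob M \<longrightarrow> (\<forall>k\<in>S. cmod (fourier M (x + k)) \<le> e) \<longrightarrow>
    cmod (\<integral>y. p y * expo x y \<partial>M) \<le> W * e"
  using assms
proof (induction rule: trig_polys.induct)
  case (monomial k c)
  have "cmod (\<integral>y. (c * expo k y) * expo x y \<partial>M) \<le> cmod c * e"
    if "\<forall>k\<in>S. cmod (fourier M (x + k)) \<le> e" for M x e
  proof -
    have "(\<integral>y. (c * expo k y) * expo x y \<partial>M) = c * fourier M (x + k)"
      by (simp add: fourier_def expo_add_left mult_ac)
    then show ?thesis
      using that monomial by (simp add: norm_mult mult_left_mono)
  qed
  then show ?case
    by (intro exI[of _ "cmod c"]) auto
next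
  case (add p q)
  from add.IH(1) obtain W where W: "W \<ge> 0"
      "\<And>M x e. borel_prob M \<Longrightarrow> (\<forall>k\<in>S. cmod (fourier M (x + k)) \<le> e) \<Longrightarrow> cmod (\<integral>y. p y * expo x y \<partial>M) \<le> W * e"
    by blast
  from add.IH(2) obtain V where V: "V \<ge> 0"
      "\<And>M x e. borel_prob M \<Longrightarrow> (\<forall>k\<in>S. cmod (fourier M (x + k)) \<le> e) \<Longrightarrow> cmod (\<integral>y. q y * expo x y \<partial>M) \<le> V * e"
    by blast
  have "cmod (\<integral>y. (p y + q y) * expo x y \<partial>M) \<le> (W + V) * e"
    if M: "borel_prob M" and e: "\<forall>k\<in>S. cmod (fourier M (x + k)) \<le> e" for M x e
  proof -
    have int: "integrable M (\<lambda>y. r y * expo x y)" if r: "r \<in> trig_polys S" for r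
    proof -
      obtain B where "\<And>y. cmod (r y) \<le> B"
        using trig_poly_bounded[OF r] by blast
      then show ?thesis
        using trig_poly_measurable[OF r]
        by (intro integrable_bounded_borel[OF M, where W = B]) (auto simp: norm_mult)
    qed
    have "(\<integral>y. (p y + q y) * expo x y \<partial>M) = (\<integral>y. p y * expo x y \<partial>M) + (\<integral>y. q y * expo x y \<partial>M)"
      using int[OF add.hyps(1)] int[OF add.hyps(2)] by (simp add: distrib_right)
    then show ?thesis
      using norm_triangle_mono[OF W(2)[OF M e] V(2)[OF M e]] by (simp add: distrib_right)
  qed
  then show ?case
    using W V by (intro exI[of _ "W + V"]) auto
qed

section \<open>A uniform lower bound for Fourier transforms modulo the lattice\<close>

text \<open>A trigonometric polynomial \<open>p\<close> approximates
  \<open>g y * expo (- x0) y\<close>. If all \<open>fourier M (x + k)\<close> were small, so would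
  be the integral of \<open>p y * expo x y\<close>; for \<open>x\<close> near \<open>x0\<close> that
  is close to the integral of \<open>g\<close>, which the mass on \<open>K\<close> keeps away from
  0. The bound is local because \<open>p\<close> depends on \<open>x0\<close>.\<close>

lemma equi_positive_local:
  fixes t x0 :: "real ^ 'd"
  assumes K: "compact K" "K \<subseteq> interior (cbox t (t + One))" and c: "c > 0"
  shows "\<exists>e>0. \<exists>d>0. \<forall>M x. borel_prob M \<longrightarrow> (AE y in M. y \<in> cbox t (t + One)) \<longrightarrow> measure M K \<ge> c \<longrightarrow>
    norm (x - x0) < d \<longrightarrow> (\<exists>k\<in>int_lattice. e \<le> cmod (fourier M (x + k)))"
proof -
  let ?C = "cbox t (t + One)"
  \<comment> \<open>The squared sines vanish on the faces of the cube and are positive in its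
    interior, hence bounded below on \<open>K\<close>.\<close>
  define g :: "real ^ 'd \<Rightarrow> real" where "g y = (\<Prod>j\<in>UNIV. (sin (pi * (y $ j - t $ j)))\<^sup>2)" for y
  have g_cont: "continuous_on A g" for A
    unfolding g_def by (intro continuous_intros)
  have g01: "0 \<le> g y" "g y \<le> 1" for y
    unfolding g_def by (auto intro!: prod_nonneg prod_le_1 simp: abs_square_le_1)
  have g_pos: "0 < g y" if "y \<in> K" for y
  proof -
    have "y \<in> box t (t + One)"
      using that K(2) by (auto simp: interior_cbox)
    then have "t $ j < y $ j" "y $ j < t $ j + 1" for j
      by (simp_all add: mem_box_cart One_nth del: sum_component)
    then have "0 < y $ j - t $ j" "y $ j - t $ j < 1" for j
      by (simp_all add: algebra_simps)
    then have "0 < sin (pi * (y $ j - t $ j))" for j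
      by (intro sin_gt_zero) auto
    then show ?thesis
      unfolding g_def by (intro prod_pos) (simp add: less_imp_neq[symmetric])
  qed
  obtain c0 where c0: "c0 > 0" "\<And>y. y \<in> K \<Longrightarrow> c0 \<le> g y"
  proof (cases "K = {}")
    case True
    then show ?thesis using that[of 1] by simp
  next
    case False
    then obtain z where "z \<in> K" "\<And>y. y \<in> K \<Longrightarrow> g z \<le> g y"
      using continuous_attains_inf[OF K(1) _ g_cont] by blast
    then show ?thesis using that[of "g z"] g_pos by blast
  qed
  define q where "q = c0 * c"
  have q: "q > 0"
    using c0 c by (simp add: q_def)
  \<comment> \<open>The factor \<open>g\<close> makes \<open>u\<close> a function on the torus
    although \<open>expo (- x0)\<close> is in general not periodic.\<close>
  define u where "u y = complex_of_real (g y) * expo (- x0) y" for y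
  have "continuous_on ?C u"
    unfolding u_def by (intro continuous_intros g_cont)
  moreover have "u y = 0" if "y $ j = t $ j \<or> y $ j = t $ j + 1" for y j
  proof -
    have "sin (pi * (y $ j - t $ j)) = 0"
      using that by auto
    then show ?thesis
      by (auto simp: u_def g_def)
  qed
  ultimately obtain p where p: "p \<in> trig_polys int_lattice" and pu: "\<And>y. y \<in> ?C \<Longrightarrow> cmod (u y - p y) < q / 4"
    using trig_poly_approx_torus[of t u "q / 4"] q by auto
  obtain W where W: "W \<ge> 0" "\<And>M x e. borel_prob M \<Longrightarrow> (\<forall>k\<in>int_lattice. cmod (fourier M (x + k)) \<le> e) \<Longrightarrow>
      cmod (\<integral>y. p y * expo x y \<partial>M) \<le> W * e"
    using trig_poly_integral_bound[OF p] by blast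
  obtain B where B: "\<And>y. cmod (p y) \<le> B"
    using trig_poly_bounded[OF p] by blast
  have "bounded ?C"
    by (rule bounded_cbox)
  then obtain \<rho> where \<rho>: "\<rho> > 0" "\<And>y. y \<in> ?C \<Longrightarrow> norm y \<le> \<rho>"
    unfolding bounded_pos by blast
  \<comment> \<open>Three errors, from the small Fourier values, from approximating \<open>u\<close>
    by \<open>p\<close> and from replacing \<open>x0\<close> by \<open>x\<close>, are each held to
    \<open>q / 4\<close>, against an integral of at least \<open>q\<close>.\<close>
  define e where "e = q / (4 * (W + 1))"
  define d where "d = q / (8 * pi * \<rho>)"
  have e: "e > 0" and We: "W * e \<le> q / 4"
    using q W(1) by (auto simp: e_def field_simps)
  have d: "d > 0"
    using q \<rho> by (simp add: d_def)
  have "\<exists>k\<in>int_lattice. e \<le> cmod (fourier M (x + k))"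
    if M: "borel_prob M" and C: "AE y in M. y \<in> ?C" and MK: "measure M K \<ge> c" and x: "norm (x - x0) < d" for M x
  proof (rule ccontr)
    assume "\<not> ?thesis"
    then have "\<forall>k\<in>int_lattice. cmod (fourier M (x + k)) \<le> e"
      by auto
    from W(2)[OF M this] We have small: "cmod (\<integral>y. p y * expo x y \<partial>M) \<le> q / 4"
      by simp
    interpret prob_space M
      using M by (simp add: borel_prob_def)
    have sets: "sets M = sets borel"
      using M by (simp add: borel_prob_def)
    have g_meas: "g \<in> borel_measurable borel"
      by (intro borel_measurable_continuous_onI g_cont)
    have g_int: "integrable M g"
      using g01 by (intro integrable_const_bound[of _ 1] borel_prob_measurable[OF M g_meas]) auto
    have K_sets: "K \<in> sets M"
      using K(1) by (simp add: sets compact_imp_closed)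
    have "q \<le> c0 * measure M K"
      using MK c0 by (simp add: q_def)
    also have "\<dots> = (\<integral>y. c0 * indicator K y \<partial>M)"
      using K_sets by simp
    also have "\<dots> \<le> (\<integral>y. g y \<partial>M)"
    proof (rule integral_mono)
      show "integrable M (\<lambda>y. c0 * indicator K y)"
        using K_sets by (intro integrable_mult_right integrable_real_indicator) (auto simp: emeasure_eq_measure)
    qed (use g_int c0 g01 in \<open>auto simp: indicator_def\<close>)
    finally have big: "q \<le> (\<integral>y. g y \<partial>M)" .
    have "cmod ((\<integral>y. p y * expo x y \<partial>M) - (\<integral>y. complex_of_real (g y) \<partial>M)) \<le> q / 2"
    proof (rule norm_integral_diff_le[OF M])
      show "integrable M (\<lambda>y. p y * expo x y)"
        using trig_poly_measurable[OF p] B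
        by (intro integrable_bounded_borel[OF M, where W = B]) (auto simp: norm_mult)
      show "integrable M (\<lambda>y. complex_of_real (g y))"
        using g_int by simp
      show "AE y in M. cmod (p y * expo x y - complex_of_real (g y)) \<le> q / 2"
        using C
      proof eventually_elim
        case (elim y)
        have "expo (- x0) y * expo x0 y = 1"
          using expo_add_left[of "- x0" x0 y] by simp
        then have "p y * expo x y - complex_of_real (g y) = - ((u y - p y) * expo x y) + u y * (expo x y - expo x0 y)"
          by (simp add: u_def algebra_simps)
        also have "cmod \<dots> \<le> cmod ((u y - p y) * expo x y) + cmod (u y * (expo x y - expo x0 y))"
          by (rule order_trans[OF norm_triangle_ineq]) simp
        also have "cmod ((u y - p y) * expo x y) \<le> q / 4"
          using pu[OF elim] by (simp add: norm_mult)
        also have "cmod (u y * (expo x y - expo x0 y)) \<le> 1 * (2 * pi * (d * \<rho>))"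
          unfolding norm_mult[of "u y"]
        proof (rule mult_mono)
          show "cmod (u y) \<le> 1"
            using g01 by (simp add: u_def norm_mult)
          show "cmod (expo x y - expo x0 y) \<le> 2 * pi * (d * \<rho>)"
            by (rule order_trans[OF norm_expo_diff_le])
              (use x \<rho>(2)[OF elim] d in \<open>auto intro!: mult_left_mono mult_mono\<close>)
        qed auto
        also have "1 * (2 * pi * (d * \<rho>)) = q / 4"
          using \<rho>(1) by (simp add: d_def field_simps)
        finally show ?case
          by simp
      qed
    qed
    then have "cmod (\<integral>y. complex_of_real (g y) \<partial>M) \<le> q / 4 + q / 2"
      using small by (smt (verit) norm_minus_commute norm_triangle_sub)
    moreover have "cmod (\<integral>y. complex_of_real (g y) \<partial>M) \<ge> q"
      using big by simp
    ultimately show False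
      using q by simp
  qed
  then show ?thesis
    using e d by blast
qed

text \<open>The conclusion is invariant under lattice translations of \<open>x\<close>, so finitely
  many balls of the local version, covering the unit cube of frequencies, suffice; \<open>e\<close>
  is the least of their constants.\<close>

lemma equi_positive:
  fixes t :: "real ^ 'd"
  assumes K: "compact K" "K \<subseteq> interior (cbox t (t + One))" and c: "c > 0"
  obtains e where "e > 0" "\<And>M x. borel_prob M \<Longrightarrow> AE y in M. y \<in> cbox t (t + One) \<Longrightarrow> measure M K \<ge> c \<Longrightarrow>
    \<exists>k\<in>int_lattice. e \<le> cmod (fourier M (x + k))"
proof -
  let ?D = "cbox 0 One :: (real ^ 'd) set"
  define P where "P M \<longleftrightarrow> borel_prob M \<and> (AE y in M. y \<in> cbox t (t + One)) \<and> measure M K \<ge> c" for M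
  have "\<forall>x0. \<exists>e d. e > 0 \<and> d > 0 \<and> (\<forall>M x. P M \<longrightarrow> norm (x - x0) < d \<longrightarrow>
      (\<exists>k\<in>int_lattice. e \<le> cmod (fourier M (x + k))))"
    using equi_positive_local[OF assms] unfolding P_def by meson
  then obtain e d where e: "\<And>x0. e x0 > (0::real)" and d: "\<And>x0. d x0 > (0::real)"
    and ed: "\<And>x0 M x. P M \<Longrightarrow> norm (x - x0) < d x0 \<Longrightarrow> \<exists>k\<in>int_lattice. e x0 \<le> cmod (fourier M (x + k))"
    by metis
  have "?D \<subseteq> (\<Union>x0\<in>?D. ball x0 (d x0))"
    using d by force
  then obtain F where F: "F \<subseteq> ?D" "finite F" "?D \<subseteq> (\<Union>x0\<in>F. ball x0 (d x0))"
    by (rule compactE_image[OF compact_cbox, rotated]) auto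
  have "(0 :: real ^ 'd) \<in> ?D"
    using mem_unit_cube[of 0 "0 :: real ^ 'd"] by simp
  with F have "F \<noteq> {}"
    by auto
  define e0 where "e0 = Min (e ` F)"
  have "e0 > 0"
    using F \<open>F \<noteq> {}\<close> e by (simp add: e0_def)
  moreover have "\<exists>k\<in>int_lattice. e0 \<le> cmod (fourier M (x + k))" if PM: "P M" for M x
  proof -
    define k0 :: "real ^ 'd" where "k0 = (\<chi> j. of_int \<lfloor>x $ j\<rfloor>)"
    have "x - k0 \<in> cbox 0 (0 + One)"
      unfolding mem_unit_cube by (auto simp: k0_def) linarith+
    then obtain x0 where x0: "x0 \<in> F" "norm (x - k0 - x0) < d x0"
      using F(3) by (auto simp: dist_norm norm_minus_commute)
    then obtain k where k: "k \<in> int_lattice" "e x0 \<le> cmod (fourier M (x - k0 + k))"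
      using ed[OF PM x0(2)] by blast
    have "e0 \<le> e x0"
      using F x0 by (simp add: e0_def)
    moreover have "k - k0 \<in> int_lattice"
      by (rule int_lattice_closed(3)[OF k(1)]) (simp add: int_lattice_def k0_def)
    ultimately show ?thesis
      using k(2) by (intro bexI[of _ "k - k0"]) (auto simp: algebra_simps)
  qed
  ultimately show ?thesis
    using that unfolding P_def by blast
qed

section \<open>Functions whose Fourier transform vanishes\<close>

lemma trig_poly_orthogonal:
  fixes f :: "'a::euclidean_space \<Rightarrow> complex"
  assumes M: "borel_prob M" and f: "integrable M f"
    and orth: "\<And>\<xi>. (\<integral>x. f x * cnj (expo \<xi> x) \<partial>M) = 0" and p: "p \<in> trig_polys UNIV"
  shows "(\<integral>x. f x * p x \<partial>M) = 0"
  using p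
proof (induction rule: trig_polys.induct)
  case (monomial k c)
  have "(\<integral>x. f x * (c * expo k x) \<partial>M) = c * (\<integral>x. f x * cnj (expo (- k) x) \<partial>M)"
    by (simp add: expo_minus_left mult_ac)
  then show ?case
    by (simp add: orth)
next
  case (add p q)
  have "integrable M (\<lambda>x. f x * r x)" if r: "r \<in> trig_polys UNIV" for r
  proof -
    obtain W where "\<And>y. cmod (r y) \<le> W"
      using trig_poly_bounded[OF r] by blast
    then show ?thesis
      by (rule integrable_mult_bounded[OF f borel_prob_measurable[OF M trig_poly_measurable[OF r]]])
  qed
  then show ?case
    using add by (simp add: distrib_left)
qed

text \<open>Approximating \<open>u\<close> on \<open>C\<close> is enough, as \<open>M\<close> is
  carried by \<open>C\<close>; the error is at most \<open>e\<close> times the L^1 norm of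
  \<open>f\<close>.\<close>

lemma continuous_orthogonal:
  fixes f u :: "'a::euclidean_space \<Rightarrow> complex"
  assumes M: "borel_prob M" and C: "compact C" "AE x in M. x \<in> C" and f: "integrable M f"
    and orth: "\<And>\<xi>. (\<integral>x. f x * cnj (expo \<xi> x) \<partial>M) = 0"
    and u: "continuous_on UNIV u" "\<And>x. cmod (u x) \<le> W"
  shows "(\<integral>x. f x * u x \<partial>M) = 0"
proof -
  have fu: "integrable M (\<lambda>x. f x * u x)"
    using u by (intro integrable_mult_bounded[OF f borel_prob_measurable[OF M]] borel_measurable_continuous_onI)
  have le: "cmod (\<integral>x. f x * u x \<partial>M) \<le> e * (\<integral>x. cmod (f x) \<partial>M)" if e: "e > 0" for e
  proof -
    obtain p where p: "p \<in> trig_polys UNIV" and pu: "\<And>y. y \<in> C \<Longrightarrow> cmod (u y - p y) < e"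
      using trig_poly_approx_compact[OF C(1) continuous_on_subset[OF u(1)] e] by auto
    obtain V where V: "\<And>y. cmod (p y) \<le> V"
      using trig_poly_bounded[OF p] by blast
    have fp: "integrable M (\<lambda>x. f x * p x)"
      by (rule integrable_mult_bounded[OF f borel_prob_measurable[OF M trig_poly_measurable[OF p]] V])
    have "(\<integral>x. f x * u x \<partial>M) = (\<integral>x. f x * u x - f x * p x \<partial>M)"
      using fu fp trig_poly_orthogonal[OF M f orth p] by simp
    also have "cmod \<dots> \<le> (\<integral>x. cmod (f x * u x - f x * p x) \<partial>M)"
      by (rule integral_norm_bound)
    also have "\<dots> \<le> (\<integral>x. e * cmod (f x) \<partial>M)"
    proof (rule integral_mono_AE)
      show "AE x in M. cmod (f x * u x - f x * p x) \<le> e * cmod (f x)"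
        using C(2)
      proof eventually_elim
        case (elim x)
        have "cmod (f x * u x - f x * p x) = cmod (u x - p x) * cmod (f x)"
          by (simp add: mult.commute flip: norm_mult right_diff_distrib)
        then show ?case
          using pu[OF elim] by (simp add: mult_right_mono)
      qed
    qed (use fu fp f in auto)
    finally show ?thesis
      by simp
  qed
  define I where "I = (\<integral>x. cmod (f x) \<partial>M)"
  have "I \<ge> 0"
    by (simp add: I_def)
  have "cmod (\<integral>x. f x * u x \<partial>M) \<le> 0 + e" if "e > 0" for e
  proof -
    \<comment> \<open>Adding 1 keeps the quotient meaningful when \<open>I\<close> is 0.\<close>
    have "cmod (\<integral>x. f x * u x \<partial>M) \<le> e / (I + 1) * I"
      using le[of "e / (I + 1)"] that \<open>I \<ge> 0\<close> unfolding I_def[symmetric] by simp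
    also have "\<dots> \<le> e"
      using that \<open>I \<ge> 0\<close> by (simp add: field_simps)
    finally show ?thesis
      by simp
  qed
  then have "cmod (\<integral>x. f x * u x \<partial>M) \<le> 0"
    by (rule field_le_epsilon)
  then show ?thesis
    by simp
qed

text \<open>Orthogonality passes from exponentials to bounded continuous functions, by dominated
  convergence to indicators of closed sets, and by a Dynkin system argument to all Borel
  sets.\<close>

lemma AE_zero_if_fourier_zero:
  fixes f :: "'a::euclidean_space \<Rightarrow> complex"
  assumes M: "borel_prob M" and C: "compact C" "AE x in M. x \<in> C" and f: "integrable M f"
    and orth: "\<And>\<xi>. (\<integral>x. f x * cnj (expo \<xi> x) \<partial>M) = 0"
  shows "AE x in M. f x = 0"
proof -
  interpret prob_space M
    using M by (simp add: borel_prob_def)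
  have sets: "sets M = sets borel" and space: "space M = UNIV"
    using M sets_eq_imp_space_eq[of M borel] by (auto simp: borel_prob_def)
  have sint: "set_integrable M A f" if "A \<in> sets M" for A
    unfolding set_integrable_def using integrable_mult_indicator[OF that f] .
  have closed: "set_lebesgue_integral M A f = 0" if A: "closed A" for A
  \<comment> \<open>The empty set is treated apart because \<open>infdist\<close> to it is 0, which
    would make every \<open>u n\<close> constantly 1.\<close>
  proof (cases "A = {}")
    case False
    \<comment> \<open>These functions are 1 on \<open>A\<close> and tend to 0 at each point off the
      closed set \<open>A\<close>.\<close>
    define u where "u n x = complex_of_real (max 0 (1 - real n * infdist x A))" for n x
    have u1: "cmod (u n x) \<le> 1" for n x
      by (simp add: u_def infdist_nonneg)
    have u_cont: "continuous_on UNIV (u n)" for n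
      unfolding u_def by (intro continuous_intros)
    have lim: "(\<lambda>n. u n x) \<longlonglongrightarrow> indicator A x" for x
    proof (cases "x \<in> A")
      case True
      then show ?thesis by (simp add: u_def)
    next
      case x: False
      then have "infdist x A > 0"
        using in_closed_iff_infdist_zero[OF A False, of x] infdist_nonneg[of x A] by linarith
      then obtain N where N: "1 < real N * infdist x A"
        using reals_Archimedean3 by blast
      have "\<forall>\<^sub>F n in sequentially. u n x = 0"
        using eventually_ge_at_top[of N]
      proof eventually_elim
        case (elim n)
        have "real N * infdist x A \<le> real n * infdist x A"
          using elim by (intro mult_right_mono infdist_nonneg) auto
        with N show ?case
          by (simp add: u_def)
      qed
      then show ?thesis
        using x by (simp add: tendsto_eventually)
    qed
    have "(\<lambda>n. \<integral>x. f x * u n x \<partial>M) \<longlonglongrightarrow> (\<integral>x. f x * indicator A x \<partial>M)"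
    proof (rule integral_dominated_convergence[where w = "\<lambda>x. cmod (f x)"])
      show "(\<lambda>x. f x * u i x) \<in> borel_measurable M" for i
        using f borel_prob_measurable[OF M borel_measurable_continuous_onI[OF u_cont[of i]]]
        by (intro borel_measurable_times) auto
      show "(\<lambda>x. f x * indicator A x) \<in> borel_measurable M"
        using f A by (auto simp: sets intro!: borel_measurable_times borel_measurable_indicator)
      show "AE x in M. (\<lambda>i. f x * u i x) \<longlonglongrightarrow> f x * indicator A x"
        by (intro AE_I2 tendsto_mult lim tendsto_const)
      show "AE x in M. cmod (f x * u i x) \<le> cmod (f x)" for i
        using u1 by (auto simp: norm_mult intro!: mult_left_le)
    qed (use f in auto)
    moreover have "(\<integral>x. f x * u n x \<partial>M) = 0" for n
      by (rule continuous_orthogonal[OF M C f orth u_cont u1])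
    ultimately have "(\<integral>x. f x * indicator A x \<partial>M) = 0"
      using LIMSEQ_unique[OF _ tendsto_const] by fastforce
    moreover have "f x * indicator A x = indicator A x *\<^sub>R f x" for x
      by (simp add: indicator_def)
    ultimately show ?thesis
      by (simp add: set_lebesgue_integral_def)
  qed (simp add: set_lebesgue_integral_def)
  have "set_lebesgue_integral M A f = 0" if A: "A \<in> sets M" for A
  proof -
    have stable: "Int_stable (Collect (closed :: 'a set \<Rightarrow> bool))"
      by (auto simp: Int_stable_def)
    from A have "A \<in> sigma_sets UNIV (Collect closed)"
      by (simp add: sets borel_eq_closed)
    with stable subset_UNIV[of "Collect closed", folded Pow_UNIV] show ?thesis
    proof (induction rule: sigma_sets_induct_disjoint)
      case (basic A)
      then show ?case using closed by simp
    next
      case empty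
      show ?case by (simp add: set_lebesgue_integral_def)
    next
      case (compl A)
      then have A: "A \<in> sets M"
        by (simp add: sets borel_eq_closed)
      have "set_lebesgue_integral M (A \<union> (UNIV - A)) f = set_lebesgue_integral M A f + set_lebesgue_integral M (UNIV - A) f"
        using A sets.compl_sets[OF A] by (intro set_integral_Un sint) (auto simp: space)
      then show ?case
        using compl closed[of UNIV] by simp
    next
      case (union A)
      then have A: "A i \<in> sets M" for i
        by (auto simp: sets borel_eq_closed)
      have "set_lebesgue_integral M (\<Union>i. A i) f = (\<Sum>i. set_lebesgue_integral M (A i) f)"
        using union A by (intro lebesgue_integral_countable_add sint) (auto simp: disjoint_family_on_def)
      then show ?case
        using union by simp
    qed
  qed
  then show ?thesis
    by (intro density_zero f)
qed

section \<open>Spectra of the finite convolutions\<close>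

lemma matrix_inv_mult:
  fixes A :: "real ^ 'd ^ 'd"
  assumes "invertible A"
  shows "A ** matrix_inv A = mat 1" "matrix_inv A ** A = mat 1"
  using someI_ex[OF assms[unfolded invertible_def]] by (simp_all add: matrix_inv_def)

lemma matrix_inv_eqI:
  fixes A :: "real ^ 'd ^ 'd"
  assumes "A ** A' = mat 1" "A' ** A = mat 1"
  shows "matrix_inv A = A'"
proof -
  have "invertible A"
    using assms by (auto simp: invertible_def)
  then have "matrix_inv A ** (A ** A') = A'"
    by (simp add: matrix_inv_mult matrix_mul_assoc)
  then show ?thesis
    by (simp add: assms)
qed

text \<open>At \<open>z = 0\<close> the determinant in \<open>expanding\<close> is that of
  \<open>A\<close> itself.\<close>

lemma expanding_invertible:
  fixes A :: "real ^ 'd ^ 'd"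
  assumes "expanding A"
  shows "invertible A"
proof -
  have "det ((\<chi> i j. complex_of_real (A $ i $ j)) :: complex ^ 'd ^ 'd) \<noteq> 0"
    using assms[unfolded expanding_def, rule_format, of 0] by simp
  moreover have "det ((\<chi> i j. complex_of_real (A $ i $ j)) :: complex ^ 'd ^ 'd) = complex_of_real (det A)"
    unfolding det_def by simp
  ultimately show ?thesis
    by (simp add: invertible_det_nz)
qed

text \<open>Row vectors stand in for transposes: \<open>\<xi> v* inv_prod R n\<close> is the
  frequency \<open>M\<^sub>n\<^sup>-\<^sup>T \<xi>\<close> at which the tail is evaluated.\<close>

lemma vector_matrix_mul_assoc: "(x v* A) v* B = x v* (A ** B)" for x :: "real ^ 'd"
  by (simp add: matrix_transpose_mul matrix_vector_mul_assoc flip: transpose_matrix_vector)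

lemma vector_matrix_add_distrib: "(x + y) v* A = x v* A + y v* A" for x :: "real ^ 'd"
  by (simp add: matrix_vector_right_distrib flip: transpose_matrix_vector)

lemma vector_matrix_mat_1 [simp]: "x v* mat 1 = x" for x :: "real ^ 'd"
  using transpose_matrix_vector[of "mat 1" x] by simp

lemma zero_vector_matrix [simp]: "0 v* A = 0" for A :: "real ^ 'd ^ 'd"
  using transpose_matrix_vector[of A 0] by simp

lemma int_lattice_vector_matrix:
  "z \<in> int_lattice \<Longrightarrow> int_matrix A \<Longrightarrow> z v* A \<in> int_lattice"
  by (auto simp: int_lattice_def int_matrix_def vector_matrix_mult_def)

lemma expo_vector_matrix: "expo (\<xi> v* A) x = expo \<xi> (A *v x)" for \<xi> :: "real ^ 'd"
  by (simp add: expo_eq_cis dot_lmul_matrix)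

lemma inv_prod_add: "inv_prod R (n + m) = inv_prod R n ** inv_prod (\<lambda>k. R (n + k)) m"
  by (induction m) (simp_all add: matrix_mul_assoc)

text \<open>The Fourier transform of \<^term>\<open>conv_partial R B n\<close>.\<close>

definition conv_fourier ::
    "(nat \<Rightarrow> real ^ 'd ^ 'd) \<Rightarrow> (nat \<Rightarrow> (real ^ 'd) set) \<Rightarrow> nat \<Rightarrow> real ^ 'd \<Rightarrow> complex" where
  "conv_fourier R B n \<xi> = (\<Prod>k=1..n. (\<Sum>b\<in>B k. expo \<xi> (inv_prod R k *v b)) / of_nat (card (B k)))"

text \<open>The Parseval identity for all exponentials characterises the spectra of the
  \<open>n\<close>-th convolution (criterion of Jorgensen and Pedersen). In this form spectra
  combine by multiplying transforms.\<close>

definition partial_spectrum ::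
    "(nat \<Rightarrow> real ^ 'd ^ 'd) \<Rightarrow> (nat \<Rightarrow> (real ^ 'd) set) \<Rightarrow> nat \<Rightarrow> (real ^ 'd) set \<Rightarrow> bool" where
  "partial_spectrum R B n \<Lambda> \<longleftrightarrow> finite \<Lambda> \<and> \<Lambda> \<subseteq> int_lattice \<and>
     (\<forall>\<xi>. (\<Sum>l\<in>\<Lambda>. (cmod (conv_fourier R B n (\<xi> + l)))\<^sup>2) = 1)"

text \<open>The last \<open>m\<close> factors are those of the shifted sequence, at the frequency
  rescaled by the first \<open>n\<close> matrices.\<close>

lemma conv_fourier_add:
  "conv_fourier R B (n + m) \<xi> =
     conv_fourier R B n \<xi> * conv_fourier (\<lambda>k. R (n + k)) (\<lambda>k. B (n + k)) m (\<xi> v* inv_prod R n)"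
proof (induction m)
  case 0
  show ?case by (simp add: conv_fourier_def)
next
  case (Suc m)
  have "inv_prod R (n + Suc m) = inv_prod R n ** inv_prod (\<lambda>k. R (n + k)) (Suc m)"
    by (rule inv_prod_add)
  then show ?case
    using Suc by (simp add: conv_fourier_def expo_vector_matrix matrix_vector_mul_assoc del: inv_prod.simps)
qed

text \<open>If \<open>i\<close> and \<open>i'\<close> had the same image, two terms would equal 1 at
  \<open>\<xi> = - G i\<close>, and the sum would be at least 2.\<close>

lemma inj_on_if_sum_norm_eq_1:
  fixes G :: "'i \<Rightarrow> 'a::group_add"
  assumes I: "finite I" and sum: "\<And>\<xi>. (\<Sum>i\<in>I. (cmod (F (\<xi> + G i)))\<^sup>2) = 1" and F0: "F 0 = 1"
  shows "inj_on G I"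
proof (rule inj_onI, rule ccontr)
  fix i i' assume i: "i \<in> I" "i' \<in> I" "G i = G i'" "i \<noteq> i'"
  have "(\<Sum>j\<in>{i, i'}. (cmod (F (- G i + G j)))\<^sup>2) \<le> (\<Sum>j\<in>I. (cmod (F (- G i + G j)))\<^sup>2)"
    using i I by (intro sum_mono2) auto
  also have "\<dots> = 1"
    by (rule sum)
  finally show False
    using i F0 by simp
qed

text \<open>Orthogonality of the rows of the unitary matrix collapses the double sum over digits to
  its diagonal; a translation then brings 0 into the spectrum.\<close>

lemma partial_spectrum_single:
  assumes adm: "admissible_pair (R 1) (B 1)"
  shows "\<exists>L. partial_spectrum R B 1 L \<and> 0 \<in> L"
proof -
  define A where "A = matrix_inv (R 1)"
  define N where "N = card (B 1)"
  obtain L where L: "finite L" "L \<subseteq> int_lattice" "card L = N"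
    and fin: "finite (B 1)" "B 1 \<noteq> {}"
    and U: "\<And>b b'. b \<in> B 1 \<Longrightarrow> b' \<in> B 1 \<Longrightarrow>
      (\<Sum>l\<in>L. adm_entry (R 1) (B 1) b l * cnj (adm_entry (R 1) (B 1) b' l)) = (if b = b' then 1 else 0)"
    using adm unfolding admissible_pair_def N_def by blast
  have N: "N > 0"
    using fin by (simp add: N_def card_gt_0_iff)
  have entry: "adm_entry (R 1) (B 1) b l = cnj (expo l (A *v b)) / complex_of_real (sqrt N)" for b l
    unfolding adm_entry_def A_def N_def expo_def exp_cnj by (simp add: inner_commute)
  have orth: "(\<Sum>l\<in>L. expo l (A *v b) * cnj (expo l (A *v b'))) = (if b = b' then of_nat N else 0)"
    if "b \<in> B 1" "b' \<in> B 1" for b b'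
  proof -
    have sq: "complex_of_real (sqrt N) * complex_of_real (sqrt N) = of_nat N"
      by (simp flip: of_real_mult)
    \<comment> \<open>The entries are conjugated exponentials, hence the exchanged roles of
      \<open>b\<close> and \<open>b'\<close>.\<close>
    have "(\<Sum>l\<in>L. expo l (A *v b) * cnj (expo l (A *v b'))) =
        of_nat N * (\<Sum>l\<in>L. adm_entry (R 1) (B 1) b' l * cnj (adm_entry (R 1) (B 1) b l))"
      unfolding entry sum_distrib_left using N by (intro sum.cong refl) (simp add: sq mult_ac)
    then show ?thesis
      using U[OF that(2,1)] by auto
  qed
  have F: "conv_fourier R B 1 \<xi> = (\<Sum>b\<in>B 1. expo \<xi> (A *v b)) / of_nat N" for \<xi>
    by (simp add: conv_fourier_def A_def N_def)
  have Q: "(\<Sum>l\<in>L. (cmod (conv_fourier R B 1 (\<xi> + l)))\<^sup>2) = 1" for \<xi>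
  proof -
    have "complex_of_real (\<Sum>l\<in>L. (cmod (conv_fourier R B 1 (\<xi> + l)))\<^sup>2) =
        (\<Sum>l\<in>L. conv_fourier R B 1 (\<xi> + l) * cnj (conv_fourier R B 1 (\<xi> + l)))"
      by (simp add: complex_norm_square[symmetric])
    also have "\<dots> = (\<Sum>l\<in>L. (\<Sum>b\<in>B 1. \<Sum>b'\<in>B 1. (expo \<xi> (A *v b) * cnj (expo \<xi> (A *v b'))) *
        (expo l (A *v b) * cnj (expo l (A *v b'))))) / (of_nat N)\<^sup>2"
      unfolding F by (simp add: sum_divide_distrib expo_add_left sum_product power2_eq_square mult_ac)
    also have "(\<Sum>l\<in>L. (\<Sum>b\<in>B 1. \<Sum>b'\<in>B 1. (expo \<xi> (A *v b) * cnj (expo \<xi> (A *v b'))) *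
        (expo l (A *v b) * cnj (expo l (A *v b'))))) =
        (\<Sum>b\<in>B 1. \<Sum>b'\<in>B 1. (expo \<xi> (A *v b) * cnj (expo \<xi> (A *v b'))) *
        (\<Sum>l\<in>L. expo l (A *v b) * cnj (expo l (A *v b'))))"
      unfolding sum_distrib_left by (subst sum.swap) (intro sum.cong refl sum.swap)
    also have "\<dots> = (\<Sum>b\<in>B 1. \<Sum>b'\<in>B 1. if b = b' then of_nat N else 0)"
      using complex_norm_square[of "expo \<xi> x" for x] by (intro sum.cong refl) (auto simp: orth)
    also have "\<dots> = (of_nat N)\<^sup>2"
      using fin by (simp add: N_def power2_eq_square)
    also have "(of_nat N)\<^sup>2 / (of_nat N)\<^sup>2 = (1 :: complex)"
      using N by simp
    finally show ?thesis
      by (metis of_real_1 of_real_eq_iff)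
  qed
  have "L \<noteq> {}"
    using L N by auto
  then obtain l0 where l0: "l0 \<in> L"
    by auto
  have "(\<Sum>l\<in>(\<lambda>l. l - l0) ` L. (cmod (conv_fourier R B 1 (\<xi> + l)))\<^sup>2) = 1" for \<xi>
    using Q[of "\<xi> - l0"] by (subst sum.reindex) (auto simp: inj_on_def algebra_simps)
  then have "partial_spectrum R B 1 ((\<lambda>l. l - l0) ` L)"
    using L l0 by (auto simp: partial_spectrum_def intro!: int_lattice_closed)
  then show ?thesis
    using l0 by force
qed

locale admissible_seq =
  fixes R :: "nat \<Rightarrow> real ^ 'd ^ 'd" and B :: "nat \<Rightarrow> (real ^ 'd) set"
  assumes adm: "\<And>n. n \<ge> 1 \<Longrightarrow> admissible_pair (R n) (B n)"
begin

lemma B_finite: "n \<ge> 1 \<Longrightarrow> finite (B n)" "n \<ge> 1 \<Longrightarrow> B n \<noteq> {}"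
  and B_lattice: "n \<ge> 1 \<Longrightarrow> B n \<subseteq> int_lattice"
  and R_int: "n \<ge> 1 \<Longrightarrow> int_matrix (R n)"
  and R_invertible: "n \<ge> 1 \<Longrightarrow> invertible (R n)"
  using adm[of n] by (auto simp: admissible_pair_def expanding_invertible)

lemma inv_prod_mult:
  "mat_prod_rev R n ** inv_prod R n = mat 1" "inv_prod R n ** mat_prod_rev R n = mat 1"
proof (induction n)
  case (Suc n)
  let ?M = "mat_prod_rev R n" and ?A = "inv_prod R n" and ?R = "R (Suc n)"
  have R: "?R ** matrix_inv ?R = mat 1" "matrix_inv ?R ** ?R = mat 1"
    using matrix_inv_mult[OF R_invertible] by auto
  have "mat_prod_rev R (Suc n) ** inv_prod R (Suc n) = ?R ** (?M ** ?A) ** matrix_inv ?R"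
    by (simp add: matrix_mul_assoc)
  then show "mat_prod_rev R (Suc n) ** inv_prod R (Suc n) = mat 1"
    by (simp add: Suc R)
  have "inv_prod R (Suc n) ** mat_prod_rev R (Suc n) = ?A ** (matrix_inv ?R ** ?R) ** ?M"
    by (simp add: matrix_mul_assoc)
  then show "inv_prod R (Suc n) ** mat_prod_rev R (Suc n) = mat 1"
    by (simp add: Suc R)
qed simp_all

lemma matrix_inv_mat_prod_rev: "matrix_inv (mat_prod_rev R n) = inv_prod R n"
  by (rule matrix_inv_eqI) (rule inv_prod_mult)+

lemma int_lattice_mat_prod_rev: "z \<in> int_lattice \<Longrightarrow> z v* mat_prod_rev R n \<in> int_lattice"
proof (induction n arbitrary: z)
  case (Suc n)
  have "z v* mat_prod_rev R (Suc n) = (z v* R (Suc n)) v* mat_prod_rev R n"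
    by (simp add: vector_matrix_mul_assoc)
  then show ?case
    using Suc int_lattice_vector_matrix[OF _ R_int] by simp
qed simp

lemma conv_fourier_0: "conv_fourier R B n 0 = 1"
  using B_finite by (auto simp: conv_fourier_def intro!: prod.neutral)

text \<open>In the last factor the additional phase is \<open>z \<bullet> b\<close>, an integer. For
  the earlier factors the last matrix is absorbed into \<open>z\<close>, which stays in the
  lattice.\<close>

lemma conv_fourier_periodic:
  "z \<in> int_lattice \<Longrightarrow> conv_fourier R B n (\<xi> + z v* mat_prod_rev R n) = conv_fourier R B n \<xi>"
proof (induction n arbitrary: z)
  case 0
  show ?case by (simp add: conv_fourier_def)
next
  case (Suc n)
  let ?z = "z v* mat_prod_rev R (Suc n)"
  have z: "z v* R (Suc n) \<in> int_lattice"
    using Suc.prems int_lattice_vector_matrix[OF _ R_int] by simp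
  have "conv_fourier R B n (\<xi> + ?z) = conv_fourier R B n \<xi>"
    using Suc.IH[OF z] by (simp add: vector_matrix_mul_assoc)
  moreover have "expo ?z (inv_prod R (Suc n) *v b) = 1" if "b \<in> B (Suc n)" for b
  proof (rule expo_eq_1)
    have "?z \<bullet> (inv_prod R (Suc n) *v b) = z \<bullet> ((mat_prod_rev R (Suc n) ** inv_prod R (Suc n)) *v b)"
      unfolding dot_lmul_matrix matrix_vector_mul_assoc ..
    also have "\<dots> = z \<bullet> b"
      unfolding inv_prod_mult by simp
    finally show "?z \<bullet> (inv_prod R (Suc n) *v b) \<in> \<int>"
      using int_lattice_inner[OF Suc.prems] B_lattice[of "Suc n"] that by auto
  qed
  then have "(\<Sum>b\<in>B (Suc n). expo (\<xi> + ?z) (inv_prod R (Suc n) *v b)) =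
      (\<Sum>b\<in>B (Suc n). expo \<xi> (inv_prod R (Suc n) *v b))"
    by (intro sum.cong refl) (simp add: expo_add_left del: inv_prod.simps mat_prod_rev.simps)
  ultimately show ?case
    by (simp add: conv_fourier_def del: inv_prod.simps mat_prod_rev.simps)
qed

lemma shift: "admissible_seq (\<lambda>k. R (n + k)) (\<lambda>k. B (n + k))"
  by unfold_locales (rule adm, simp)

text \<open>At \<open>\<xi> = - l'\<close> the term of \<open>l'\<close> alone is 1, so every other
  term vanishes.\<close>

lemma partial_spectrum_orthogonal:
  assumes "partial_spectrum R B n \<Lambda>" "l \<in> \<Lambda>" "l' \<in> \<Lambda>" "l \<noteq> l'"
  shows "conv_fourier R B n (l - l') = 0"
proof -
  have "(\<Sum>j\<in>{l, l'}. (cmod (conv_fourier R B n (- l' + j)))\<^sup>2) \<le> (\<Sum>j\<in>\<Lambda>. (cmod (conv_fourier R B n (- l' + j)))\<^sup>2)"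
    using assms by (intro sum_mono2) (auto simp: partial_spectrum_def)
  also have "\<dots> = 1"
    using assms(1) unfolding partial_spectrum_def by blast
  finally show ?thesis
    using assms by (simp add: conv_fourier_0)
qed

text \<open>Elements of a spectrum of the \<open>n\<close>-th convolution may be moved by the period lattice, so the
  correction \<open>\<kappa>\<close> is free; it is chosen later to keep the tail's transform away from \<open>0\<close>.\<close>

lemma partial_spectrum_extend:
  assumes \<Lambda>: "partial_spectrum R B n \<Lambda>"
    and D: "partial_spectrum (\<lambda>k. R (n + k)) (\<lambda>k. B (n + k)) m D"
    and \<kappa>: "\<And>l d. l \<in> \<Lambda> \<Longrightarrow> d \<in> D \<Longrightarrow> \<kappa> l d \<in> int_lattice"
  shows "partial_spectrum R B (n + m)
    ((\<lambda>(l, d). l + d v* mat_prod_rev R n + \<kappa> l d v* mat_prod_rev R (n + m)) ` (\<Lambda> \<times> D))"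
proof -
  interpret S: admissible_seq "\<lambda>k. R (n + k)" "\<lambda>k. B (n + k)"
    by (rule shift)
  let ?F = "conv_fourier R B (n + m)" and ?F1 = "conv_fourier R B n"
    and ?F2 = "conv_fourier (\<lambda>k. R (n + k)) (\<lambda>k. B (n + k)) m"
  define G where "G = (\<lambda>(l, d). l + d v* mat_prod_rev R n + \<kappa> l d v* mat_prod_rev R (n + m))"
  have fin: "finite \<Lambda>" "finite D" and sub: "\<Lambda> \<subseteq> int_lattice" "D \<subseteq> int_lattice"
    using \<Lambda> D by (auto simp: partial_spectrum_def)
  \<comment> \<open>Periodicity at level \<open>n + m\<close> removes \<open>\<kappa>\<close>, and
    periodicity at level \<open>n\<close> removes \<open>d\<close> from the first factor; in the
    second factor \<open>d\<close> survives as a translation after rescaling.\<close>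
  have F: "?F (\<xi> + G (l, d)) = ?F1 (\<xi> + l) * ?F2 ((\<xi> + l) v* inv_prod R n + d)"
    if l: "l \<in> \<Lambda>" and d: "d \<in> D" for \<xi> l d
  proof -
    have "?F (\<xi> + G (l, d)) = ?F (\<xi> + l + d v* mat_prod_rev R n)"
      using conv_fourier_periodic[OF \<kappa>[OF l d], of "n + m" "\<xi> + l + d v* mat_prod_rev R n"]
      by (simp add: G_def add.assoc)
    also have "\<dots> = ?F1 (\<xi> + l) * ?F2 ((\<xi> + l + d v* mat_prod_rev R n) v* inv_prod R n)"
      using conv_fourier_periodic[of d n "\<xi> + l"] d sub by (auto simp: conv_fourier_add)
    also have "(\<xi> + l + d v* mat_prod_rev R n) v* inv_prod R n = (\<xi> + l) v* inv_prod R n + d"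
      by (simp add: vector_matrix_add_distrib vector_matrix_mul_assoc inv_prod_mult)
    finally show ?thesis .
  qed
  have sum: "(\<Sum>i\<in>\<Lambda> \<times> D. (cmod (?F (\<xi> + G i)))\<^sup>2) = 1" for \<xi>
  proof -
    have "(\<Sum>i\<in>\<Lambda> \<times> D. (cmod (?F (\<xi> + G i)))\<^sup>2) = (\<Sum>l\<in>\<Lambda>. \<Sum>d\<in>D. (cmod (?F (\<xi> + G (l, d))))\<^sup>2)"
      by (simp add: sum.cartesian_product)
    also have "\<dots> = (\<Sum>l\<in>\<Lambda>. (cmod (?F1 (\<xi> + l)))\<^sup>2 * (\<Sum>d\<in>D. (cmod (?F2 ((\<xi> + l) v* inv_prod R n + d)))\<^sup>2))"
      by (simp add: F norm_mult power_mult_distrib sum_distrib_left)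
    also have "\<dots> = 1"
      using \<Lambda> D by (simp add: partial_spectrum_def)
    finally show ?thesis .
  qed
  \<comment> \<open>The identity so far runs over pairs; injectivity turns it into a sum over the
    set of images.\<close>
  have "inj_on G (\<Lambda> \<times> D)"
    using fin by (intro inj_on_if_sum_norm_eq_1[where F = ?F] sum conv_fourier_0) auto
  then have "(\<Sum>l\<in>G ` (\<Lambda> \<times> D). (cmod (?F (\<xi> + l)))\<^sup>2) = 1" for \<xi>
    using sum[of \<xi>] by (simp add: sum.reindex)
  moreover have "G ` (\<Lambda> \<times> D) \<subseteq> int_lattice"
    using sub \<kappa> by (auto simp: G_def intro!: int_lattice_closed(2) int_lattice_mat_prod_rev)
  ultimately show ?thesis
    using fin unfolding partial_spectrum_def G_def by blast
qed

text \<open>Pairs are added one at a time with no correction. Membership of 0 is carried along so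
  that an extension by this set can retain the old elements.\<close>

lemma partial_spectrum_exists: "\<exists>\<Lambda>. partial_spectrum R B n \<Lambda> \<and> 0 \<in> \<Lambda>"
proof (induction n)
  case 0
  show ?case
    by (intro exI[of _ "{0}"]) (simp add: partial_spectrum_def conv_fourier_def int_lattice_closed)
next
  case (Suc n)
  then obtain \<Lambda> where \<Lambda>: "partial_spectrum R B n \<Lambda>" "0 \<in> \<Lambda>"
    by blast
  obtain D where D: "partial_spectrum (\<lambda>k. R (n + k)) (\<lambda>k. B (n + k)) 1 D" "0 \<in> D"
    using partial_spectrum_single[of "\<lambda>k. R (n + k)" "\<lambda>k. B (n + k)"] adm by auto
  let ?G = "\<lambda>(l, d). l + d v* mat_prod_rev R n + 0 v* mat_prod_rev R (n + 1)"
  have "partial_spectrum R B (n + 1) (?G ` (\<Lambda> \<times> D))"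
    by (rule partial_spectrum_extend[OF \<Lambda>(1) D(1)]) (rule int_lattice_closed(1))
  moreover have "0 \<in> ?G ` (\<Lambda> \<times> D)"
    using \<Lambda> D by (intro image_eqI[of _ _ "(0, 0)"]) auto
  ultimately show ?case
    unfolding Suc_eq_plus1 by blast
qed

end

section \<open>The infinite convolution\<close>

text \<open>Only the digits with index at least 1 are used; \<open>B 0\<close> is arbitrary.\<close>

definition digit_space :: "(nat \<Rightarrow> (real ^ 'd) set) \<Rightarrow> (nat \<Rightarrow> real ^ 'd) measure" where
  "digit_space B = PiM UNIV (\<lambda>k. measure_pmf (pmf_of_set (B k)))"

definition digit_sum :: "(nat \<Rightarrow> real ^ 'd ^ 'd) \<Rightarrow> nat \<Rightarrow> (nat \<Rightarrow> real ^ 'd) \<Rightarrow> real ^ 'd" where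
  "digit_sum R n \<omega> = (\<Sum>k=1..n. inv_prod R k *v \<omega> k)"

text \<open>Where the sums diverge the value of \<open>lim\<close> is unspecified; under the cube
  hypotheses this happens only on a null set.\<close>

definition inf_conv :: "(nat \<Rightarrow> real ^ 'd ^ 'd) \<Rightarrow> (nat \<Rightarrow> (real ^ 'd) set) \<Rightarrow> (real ^ 'd) measure" where
  "inf_conv R B = distr (digit_space B) borel (\<lambda>\<omega>. lim (\<lambda>n. digit_sum R n \<omega>))"

section \<open>Norm bounds for matrix-vector products\<close>

lemma norm_matrix_vector_le:
  fixes A :: "real ^ 'd ^ 'd"
  shows "norm (A *v x) \<le> real CARD('d) * norm A * norm x"
proof -
  have "norm (A *v x) \<le> (\<Sum>i\<in>UNIV. \<bar>(A *v x) $ i\<bar>)"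
    by (rule norm_le_l1_cart)
  also have "\<dots> \<le> (\<Sum>i\<in>(UNIV :: 'd set). norm A * norm x)"
  proof (rule sum_mono)
    fix i
    have "\<bar>(A *v x) $ i\<bar> \<le> norm (A $ i) * norm x"
      unfolding matrix_vector_mul_component by (rule Cauchy_Schwarz_ineq2)
    also have "\<dots> \<le> norm A * norm x"
      by (intro mult_right_mono Finite_Cartesian_Product.norm_nth_le) auto
    finally show "\<bar>(A *v x) $ i\<bar> \<le> norm A * norm x" .
  qed
  finally show ?thesis
    by simp
qed

lemma norm_vector_matrix_le:
  fixes A :: "real ^ 'd ^ 'd"
  shows "norm (x v* A) \<le> real CARD('d) * norm A * norm x"
proof (cases "norm (x v* A) = 0")
  case False
  have "norm (x v* A) * norm (x v* A) = x \<bullet> (A *v (x v* A))"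
    using dot_lmul_matrix[of x A "x v* A"] by (simp add: power2_norm_eq_inner flip: power2_eq_square)
  also have "\<dots> \<le> norm x * norm (A *v (x v* A))"
    by (rule norm_cauchy_schwarz)
  also have "\<dots> \<le> norm x * (real CARD('d) * norm A * norm (x v* A))"
    by (intro mult_left_mono norm_matrix_vector_le) auto
  finally have "norm (x v* A) * norm (x v* A) \<le> (real CARD('d) * norm A * norm x) * norm (x v* A)"
    by (simp add: mult_ac)
  then show ?thesis
    using False by (simp add: mult_le_cancel_right)
qed simp

section \<open>Independent random digits\<close>

lemma prob_space_digit_space: "prob_space (digit_space B)"
  unfolding digit_space_def by (intro prob_space_PiM measure_pmf.prob_space_axioms)

lemma measurable_digit [measurable]:
  fixes f :: "real ^ 'd \<Rightarrow> 'b::topological_space"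
  shows "(\<lambda>\<omega>. f (\<omega> k)) \<in> borel_measurable (digit_space B)"
proof -
  have "(\<lambda>\<omega>. \<omega> k) \<in> measurable (digit_space B) (measure_pmf (pmf_of_set (B k)))"
    unfolding digit_space_def by (rule measurable_component_singleton) simp
  then show ?thesis
    by (rule measurable_compose) simp
qed

lemma measurable_digit_sum [measurable]: "digit_sum R n \<in> borel_measurable (digit_space B)"
  unfolding digit_sum_def by measurable

lemma distr_digit:
  fixes f :: "real ^ 'd \<Rightarrow> 'b::topological_space"
  shows "distr (digit_space B) borel (\<lambda>\<omega>. f (\<omega> k)) = distr (measure_pmf (pmf_of_set (B k))) borel f"
proof -
  have 1: "(\<lambda>\<omega>. \<omega> k) \<in> measurable (digit_space B) (measure_pmf (pmf_of_set (B k)))"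
    unfolding digit_space_def by (rule measurable_component_singleton) simp
  have 2: "distr (digit_space B) (measure_pmf (pmf_of_set (B k))) (\<lambda>\<omega>. \<omega> k) = measure_pmf (pmf_of_set (B k))"
    unfolding digit_space_def by (rule distr_PiM_component) (auto simp: measure_pmf.prob_space_axioms)
  have "distr (digit_space B) borel (\<lambda>\<omega>. f (\<omega> k)) =
      distr (distr (digit_space B) (measure_pmf (pmf_of_set (B k))) (\<lambda>\<omega>. \<omega> k)) borel f"
    by (subst distr_distr[OF _ 1]) (simp_all add: comp_def)
  then show ?thesis
    by (simp add: 2)
qed

lemma indep_digits:
  fixes f :: "nat \<Rightarrow> real ^ 'd \<Rightarrow> 'b::topological_space"
  shows "prob_space.indep_vars (digit_space B) (\<lambda>_. borel) (\<lambda>k \<omega>. f k (\<omega> k)) UNIV"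
proof -
  interpret prob_space "digit_space B"
    by (rule prob_space_digit_space)
  let ?M = "\<lambda>k. measure_pmf (pmf_of_set (B k))"
  have "indep_vars ?M (\<lambda>k \<omega>. \<omega> k) UNIV"
  proof (subst indep_vars_iff_distr_eq_PiM')
    show "random_variable (?M i) (\<lambda>\<omega>. \<omega> i)" for i
      unfolding digit_space_def by (rule measurable_component_singleton) simp
    have "distr (digit_space B) (?M i) (\<lambda>\<omega>. \<omega> i) = ?M i" for i
      unfolding digit_space_def by (rule distr_PiM_component) (auto simp: measure_pmf.prob_space_axioms)
    then show "distr (digit_space B) (PiM UNIV ?M) (\<lambda>x. \<lambda>i\<in>UNIV. x i) =
        PiM UNIV (\<lambda>i. distr (digit_space B) (?M i) (\<lambda>\<omega>. \<omega> i))"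
      by (simp add: restrict_UNIV digit_space_def distr_id)
  qed simp
  then show ?thesis
    by (rule indep_vars_compose2) simp
qed

section \<open>Convergence of the random series inside the cube\<close>

locale cube_seq = admissible_seq R B
  for R :: "nat \<Rightarrow> real ^ 'd ^ 'd" and B :: "nat \<Rightarrow> (real ^ 'd) set" +
  fixes t0 :: "real ^ 'd"
  assumes lim: "(\<lambda>n. norm (inv_prod R n)) \<longlonglongrightarrow> 0"
    and cube_inv: "\<And>n b. n \<ge> 1 \<Longrightarrow> b \<in> B n \<Longrightarrow>
           (\<lambda>x. matrix_inv (R n) *v (x + b)) ` cbox t0 (t0 + One) \<subseteq> cbox t0 (t0 + One)"
begin

abbreviation "C \<equiv> cbox t0 (t0 + One)"

text \<open>The products of the shifted sequence are the fixed matrix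
  \<open>mat_prod_rev R n\<close> times products that tend to 0.\<close>

lemma cube_seq_shift: "cube_seq (\<lambda>k. R (n + k)) (\<lambda>k. B (n + k)) t0"
proof (intro cube_seq.intro shift cube_seq_axioms.intro)
  let ?A = "\<lambda>m. inv_prod (\<lambda>k. R (n + k)) m"
  have A: "?A m = mat_prod_rev R n ** inv_prod R (n + m)" for m
    by (simp add: inv_prod_add matrix_mul_assoc inv_prod_mult)
  have "(\<lambda>m. norm (inv_prod R (n + m))) \<longlonglongrightarrow> 0"
    using LIMSEQ_ignore_initial_segment[OF lim, of n] by (simp add: add.commute)
  then have "(\<lambda>m. inv_prod R (n + m)) \<longlonglongrightarrow> 0"
    by (simp add: tendsto_norm_zero_iff)
  then have "(\<lambda>m. inv_prod R (n + m) $ i $ j) \<longlonglongrightarrow> 0" for i j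
    using tendsto_vec_nth[of _ "0 :: real ^ 'd ^ 'd"] tendsto_vec_nth[of _ "0 :: real ^ 'd"] by fastforce
  then have "(\<lambda>m. \<Sum>k\<in>UNIV. mat_prod_rev R n $ i $ k * inv_prod R (n + m) $ k $ j) \<longlonglongrightarrow> (\<Sum>k\<in>(UNIV::'d set). mat_prod_rev R n $ i $ k * 0)" for i j
    by (intro tendsto_intros)
  then have "(\<lambda>m. ?A m $ i $ j) \<longlonglongrightarrow> 0" for i j
    by (simp add: A matrix_matrix_mult_def)
  then have "?A \<longlonglongrightarrow> 0"
    by (intro vec_tendstoI) simp
  then show "(\<lambda>m. norm (?A m)) \<longlonglongrightarrow> 0"
    by (rule tendsto_norm_zero)
qed (rule cube_inv, simp_all)

text \<open>Invariance of the cube absorbs one digit at a time, so the affine images of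
  \<open>C\<close> given by longer digit strings are nested in those given by shorter ones.\<close>

lemma digit_sum_nested:
  assumes \<omega>: "\<And>k. k \<ge> 1 \<Longrightarrow> \<omega> k \<in> B k" and y: "y \<in> C"
  shows "\<exists>y'\<in>C. digit_sum R (m + j) \<omega> + inv_prod R (m + j) *v y = digit_sum R m \<omega> + inv_prod R m *v y'"
  using y
proof (induction j arbitrary: y)
  case 0
  then show ?case by auto
next
  case (Suc j)
  let ?n = "m + j"
  have y': "matrix_inv (R (Suc ?n)) *v (y + \<omega> (Suc ?n)) \<in> C"
    using cube_inv[of "Suc ?n" "\<omega> (Suc ?n)"] \<omega>[of "Suc ?n"] Suc.prems by auto
  have "digit_sum R (Suc ?n) \<omega> + inv_prod R (Suc ?n) *v y =
      digit_sum R ?n \<omega> + inv_prod R ?n *v (matrix_inv (R (Suc ?n)) *v (y + \<omega> (Suc ?n)))"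
    by (simp add: digit_sum_def matrix_vector_mul_assoc matrix_vector_right_distrib)
  then show ?case
    using Suc.IH[OF y'] by simp
qed

lemma t0_in_C: "t0 \<in> C"
  by (simp add: mem_unit_cube)

lemma inv_prod_tendsto_0: "(\<lambda>n. inv_prod R n *v x) \<longlonglongrightarrow> 0" "(\<lambda>n. x v* inv_prod R n) \<longlonglongrightarrow> 0"
proof -
  have *: "(\<lambda>n. real CARD('d) * norm (inv_prod R n) * norm x) \<longlonglongrightarrow> 0"
    using tendsto_mult_left_zero[OF tendsto_mult_right_zero[OF lim]] by fastforce
  show "(\<lambda>n. inv_prod R n *v x) \<longlonglongrightarrow> 0"
    by (rule Lim_null_comparison[OF _ *]) (simp add: norm_matrix_vector_le)
  show "(\<lambda>n. x v* inv_prod R n) \<longlonglongrightarrow> 0"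
    by (rule Lim_null_comparison[OF _ *]) (simp add: norm_vector_matrix_le)
qed

lemma digit_sum_convergent:
  assumes \<omega>: "\<And>k. k \<ge> 1 \<Longrightarrow> \<omega> k \<in> B k"
  shows "(\<lambda>n. digit_sum R n \<omega>) \<longlonglongrightarrow> lim (\<lambda>n. digit_sum R n \<omega>)"
proof -
  \<comment> \<open>As 0 need not lie in \<open>C\<close>, the partial sums may leave the nested
    images; adding the image of \<open>t0\<close> puts them inside at the cost of a null
    sequence.\<close>
  define Z where "Z n = digit_sum R n \<omega> + inv_prod R n *v t0" for n
  obtain \<rho> where \<rho>: "\<rho> > 0" "\<And>y. y \<in> C \<Longrightarrow> norm y \<le> \<rho>"
    using bounded_cbox[of t0 "t0 + One"] unfolding bounded_pos by blast
  have le: "norm (Z (m + j) - Z m) \<le> real CARD('d) * norm (inv_prod R m) * (2 * \<rho>)" for m j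
  proof -
    obtain y' where y': "y' \<in> C" "Z (m + j) = digit_sum R m \<omega> + inv_prod R m *v y'"
      using digit_sum_nested[OF \<omega> t0_in_C, where m = m and j = j] by (auto simp: Z_def)
    have "Z (m + j) - Z m = inv_prod R m *v (y' - t0)"
      using y' by (simp add: Z_def matrix_vector_mult_diff_distrib)
    then have "norm (Z (m + j) - Z m) \<le> real CARD('d) * norm (inv_prod R m) * norm (y' - t0)"
      using norm_matrix_vector_le by simp
    also have "\<dots> \<le> real CARD('d) * norm (inv_prod R m) * (2 * \<rho>)"
      using \<rho>(2)[OF y'(1)] \<rho>(2)[OF t0_in_C] norm_triangle_ineq4[of y' t0]
      by (intro mult_left_mono) auto
    finally show ?thesis .
  qed
  have lim0: "(\<lambda>m. real CARD('d) * norm (inv_prod R m) * (2 * \<rho>)) \<longlonglongrightarrow> 0"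
    using tendsto_mult_left_zero[OF tendsto_mult_right_zero[OF lim]] by fastforce
  have "Cauchy Z"
  proof (rule CauchyI')
    fix e :: real assume "e > 0"
    then obtain N where N: "\<And>m. m \<ge> N \<Longrightarrow> real CARD('d) * norm (inv_prod R m) * (2 * \<rho>) < e"
      using order_tendstoD(2)[OF lim0] unfolding eventually_sequentially by blast
    have "norm (Z m - Z n) < e" if "m \<ge> N" "n > m" for m n
      using le[of m "n - m"] N[OF that(1)] that by (simp add: norm_minus_commute)
    then show "\<exists>M. \<forall>m\<ge>M. \<forall>n>m. dist (Z m) (Z n) < e"
      unfolding dist_norm by blast
  qed
  then have "convergent Z"
    by (rule Cauchy_convergent)
  then obtain z where "Z \<longlonglongrightarrow> z"
    by (auto simp: convergent_def)
  from tendsto_diff[OF this inv_prod_tendsto_0(1)[of t0]] have "(\<lambda>n. digit_sum R n \<omega>) \<longlonglongrightarrow> z"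
    by (simp add: Z_def)
  then show ?thesis
    using limI by blast
qed

text \<open>The affine images are compact, so the limit stays in them. Taking \<open>m = 0\<close>
  places it in \<open>C\<close>, and \<open>m = 1\<close> retains the first digit.\<close>

lemma digit_limit_in:
  assumes \<omega>: "\<And>k. k \<ge> 1 \<Longrightarrow> \<omega> k \<in> B k"
  shows "lim (\<lambda>n. digit_sum R n \<omega>) \<in> (\<lambda>y. digit_sum R m \<omega> + inv_prod R m *v y) ` C"
proof (rule closed_sequentially)
  have "compact ((\<lambda>y. digit_sum R m \<omega> + inv_prod R m *v y) ` C)"
    by (intro compact_continuous_image continuous_intros compact_cbox
        linear_continuous_on matrix_vector_mul_bounded_linear)
  then show "closed ((\<lambda>y. digit_sum R m \<omega> + inv_prod R m *v y) ` C)"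
    by (rule compact_imp_closed)
  show "digit_sum R (m + j) \<omega> + inv_prod R (m + j) *v t0 \<in> (\<lambda>y. digit_sum R m \<omega> + inv_prod R m *v y) ` C" for j
    using digit_sum_nested[OF \<omega> t0_in_C, where m = m and j = j] by auto
  have "(\<lambda>n. digit_sum R n \<omega> + inv_prod R n *v t0) \<longlonglongrightarrow> lim (\<lambda>n. digit_sum R n \<omega>) + 0"
    by (intro tendsto_add digit_sum_convergent \<omega> inv_prod_tendsto_0)
  from LIMSEQ_ignore_initial_segment[OF this, of m]
  show "(\<lambda>j. digit_sum R (m + j) \<omega> + inv_prod R (m + j) *v t0) \<longlonglongrightarrow> lim (\<lambda>n. digit_sum R n \<omega>)"
    by (simp add: add.commute)
qed

lemma AE_digits: "AE \<omega> in digit_space B. \<forall>k\<ge>1. \<omega> k \<in> B k"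
proof -
  have "AE \<omega> in digit_space B. k \<ge> 1 \<longrightarrow> \<omega> k \<in> B k" for k
  proof (cases "k \<ge> 1")
    case True
    have "AE x in measure_pmf (pmf_of_set (B k)). x \<in> B k"
      using B_finite[OF True] by (simp add: AE_measure_pmf_iff)
    then show ?thesis
      unfolding digit_space_def
      using AE_PiM_component[of UNIV "\<lambda>k. measure_pmf (pmf_of_set (B k))" k "\<lambda>x. x \<in> B k"]
      by (auto simp: measure_pmf.prob_space_axioms)
  qed simp
  then show ?thesis
    by (simp add: AE_all_countable)
qed

lemma AE_digit_limit_in_C: "AE \<omega> in digit_space B. lim (\<lambda>n. digit_sum R n \<omega>) \<in> C"
  using AE_digits
proof eventually_elim
  case (elim \<omega>)
  then show ?case using digit_limit_in[of \<omega> 0] by (auto simp: digit_sum_def)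
qed

lemma measurable_digit_limit [measurable]: "(\<lambda>\<omega>. lim (\<lambda>n. digit_sum R n \<omega>)) \<in> borel_measurable (digit_space B)"
  by measurable

lemma borel_prob_inf_conv: "borel_prob (inf_conv R B)"
  unfolding borel_prob_def inf_conv_def
  by (simp add: prob_space.prob_space_distr[OF prob_space_digit_space])

lemma AE_inf_conv: "AE x in inf_conv R B. x \<in> C"
  unfolding inf_conv_def using AE_digit_limit_in_C by (subst AE_distr_iff) auto

section \<open>Weak convergence and factorisation of the Fourier transform\<close>

lemma integral_digit_sum_tendsto:
  fixes f :: "real ^ 'd \<Rightarrow> 'b::{banach, second_countable_topology}"
  assumes f: "continuous_on UNIV f" "\<And>x. norm (f x) \<le> W"
  shows "(\<lambda>n. \<integral>\<omega>. f (digit_sum R n \<omega>) \<partial>digit_space B) \<longlonglongrightarrow> (\<integral>x. f x \<partial>inf_conv R B)"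
proof -
  interpret prob_space "digit_space B"
    by (rule prob_space_digit_space)
  have [measurable]: "f \<in> borel_measurable borel"
    using f(1) by (rule borel_measurable_continuous_onI)
  have "(\<lambda>n. \<integral>\<omega>. f (digit_sum R n \<omega>) \<partial>digit_space B) \<longlonglongrightarrow> (\<integral>\<omega>. f (lim (\<lambda>n. digit_sum R n \<omega>)) \<partial>digit_space B)"
  proof (rule integral_dominated_convergence[where w = "\<lambda>_. W"])
    show "AE \<omega> in digit_space B. (\<lambda>n. f (digit_sum R n \<omega>)) \<longlonglongrightarrow> f (lim (\<lambda>n. digit_sum R n \<omega>))"
      using AE_digits
    proof eventually_elim
      case (elim \<omega>)
      then show ?case
        using continuous_on_tendsto_compose[OF f(1) digit_sum_convergent] by simp
    qed
  qed (use f(2) in auto)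
  then show ?thesis
    unfolding inf_conv_def by (simp add: integral_distr)
qed

text \<open>The next digit is independent of the earlier ones, so adding it to the sum convolves the
  laws.\<close>

lemma conv_partial_eq: "conv_partial R B n = distr (digit_space B) borel (digit_sum R n)"
proof (induction n)
  case 0
  interpret prob_space "digit_space B"
    by (rule prob_space_digit_space)
  show ?case
    by (simp add: digit_sum_def distr_const)
next
  case (Suc n)
  interpret prob_space "digit_space B"
    by (rule prob_space_digit_space)
  let ?A = "inv_prod R (Suc n)" and ?B = "B (Suc n)"
  \<comment> \<open>Distinct digits have distinct images, so the uniform law on the image set is the
    image of the uniform law on the digits.\<close>
  have inj: "inj_on (\<lambda>b. ?A *v b) ?B"
  proof (rule inj_on_inverseI)
    show "mat_prod_rev R (Suc n) *v (?A *v b) = b" for b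
      unfolding matrix_vector_mul_assoc inv_prod_mult by simp
  qed
  have "delta_set ((\<lambda>b. ?A *v b) ` ?B) = distr (measure_pmf (pmf_of_set ?B)) borel (\<lambda>b. ?A *v b)"
    unfolding delta_set_def using B_finite[of "Suc n"]
    by (subst map_pmf_of_set_inj[OF inj, symmetric])
      (auto simp: map_pmf_rep_eq distr_distr comp_def simp del: inv_prod.simps)
  also have "\<dots> = distr (digit_space B) borel (\<lambda>\<omega>. ?A *v \<omega> (Suc n))"
    by (rule distr_digit[symmetric])
  finally have step: "delta_set ((\<lambda>b. ?A *v b) ` ?B) = distr (digit_space B) borel (\<lambda>\<omega>. ?A *v \<omega> (Suc n))" .
  have "indep_vars (\<lambda>_. borel) (\<lambda>k \<omega>. inv_prod R k *v \<omega> k) UNIV"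
    by (rule indep_digits)
  then have "indep_var borel ((\<lambda>f. \<Sum>k=1..n. f k) \<circ> (\<lambda>\<omega>. \<lambda>k\<in>{1..n}. inv_prod R k *v \<omega> k))
      borel ((\<lambda>f. f (Suc n)) \<circ> (\<lambda>\<omega>. \<lambda>k\<in>{Suc n}. inv_prod R k *v \<omega> k))"
    by (intro indep_var_compose[OF indep_var_restrict]) auto
  moreover have "((\<lambda>f. \<Sum>k=1..n. f k) \<circ> (\<lambda>\<omega>. \<lambda>k\<in>{1..n}. inv_prod R k *v \<omega> k)) = digit_sum R n"
    by (auto simp: digit_sum_def fun_eq_iff)
  moreover have "((\<lambda>f. f (Suc n)) \<circ> (\<lambda>\<omega>. \<lambda>k\<in>{Suc n}. inv_prod R k *v \<omega> k)) = (\<lambda>\<omega>. ?A *v \<omega> (Suc n))"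
    by (auto simp: fun_eq_iff)
  ultimately have "indep_var borel (digit_sum R n) borel (\<lambda>\<omega>. ?A *v \<omega> (Suc n))"
    by simp
  then have "distr (digit_space B) borel (\<lambda>\<omega>. digit_sum R n \<omega> + ?A *v \<omega> (Suc n)) =
      convolution (distr (digit_space B) borel (digit_sum R n)) (distr (digit_space B) borel (\<lambda>\<omega>. ?A *v \<omega> (Suc n)))"
    by (rule sum_indep_random_variable) measurable
  moreover have "(\<lambda>\<omega>. digit_sum R n \<omega> + ?A *v \<omega> (Suc n)) = digit_sum R (Suc n)"
    by (simp add: digit_sum_def fun_eq_iff)
  ultimately show ?case
    by (simp only: conv_partial.simps matrix_inv_mat_prod_rev Suc.IH step)
qed

lemma weak_conv_inf_conv: "weak_conv_to (conv_partial R B) (inf_conv R B)"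
  unfolding weak_conv_to_def
proof (intro allI impI, elim conjE)
  fix f :: "real ^ 'd \<Rightarrow> real"
  assume f: "continuous_on UNIV f" "bounded (range f)"
  then obtain W where W: "\<And>x. norm (f x) \<le> W"
    by (auto simp: bounded_iff)
  have "f \<in> borel_measurable borel"
    using f(1) by (rule borel_measurable_continuous_onI)
  then have "(\<integral>x. f x \<partial>conv_partial R B n) = (\<integral>\<omega>. f (digit_sum R n \<omega>) \<partial>digit_space B)" for n
    unfolding conv_partial_eq by (intro integral_distr) auto
  then show "(\<lambda>n. \<integral>x. f x \<partial>conv_partial R B n) \<longlonglongrightarrow> (\<integral>x. f x \<partial>inf_conv R B)"
    using integral_digit_sum_tendsto[OF f(1) W] by simp
qed

lemma integral_expo_digit_sum:
  "(\<integral>\<omega>. expo \<xi> (digit_sum R n \<omega>) \<partial>digit_space B) = conv_fourier R B n \<xi>"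
proof -
  interpret prob_space "digit_space B"
    by (rule prob_space_digit_space)
  have "(\<integral>\<omega>. expo \<xi> (digit_sum R n \<omega>) \<partial>digit_space B) =
      (\<integral>\<omega>. (\<Prod>k=1..n. expo \<xi> (inv_prod R k *v \<omega> k)) \<partial>digit_space B)"
    by (simp add: digit_sum_def expo_sum_right)
  also have "\<dots> = (\<Prod>k=1..n. \<integral>\<omega>. expo \<xi> (inv_prod R k *v \<omega> k) \<partial>digit_space B)"
  proof (rule indep_vars_lebesgue_integral)
    show "indep_vars (\<lambda>_. borel) (\<lambda>k \<omega>. expo \<xi> (inv_prod R k *v \<omega> k)) {1..n}"
      by (rule indep_vars_subset[OF indep_digits]) simp
    show "integrable (digit_space B) (\<lambda>\<omega>. expo \<xi> (inv_prod R k *v \<omega> k))" for k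
      by (rule integrable_const_bound[where B = 1]) (auto intro: measurable_digit)
  qed simp
  also have "\<dots> = conv_fourier R B n \<xi>"
    unfolding conv_fourier_def
  proof (rule prod.cong)
    fix k assume "k \<in> {1..n}"
    then have k: "k \<ge> 1"
      by simp
    have "(\<integral>\<omega>. expo \<xi> (inv_prod R k *v \<omega> k) \<partial>digit_space B) =
        (\<integral>x. x \<partial>distr (digit_space B) borel (\<lambda>\<omega>. expo \<xi> (inv_prod R k *v \<omega> k)))"
      by (rule integral_distr[symmetric]) (auto intro: measurable_digit)
    also have "\<dots> = (\<integral>x. x \<partial>distr (measure_pmf (pmf_of_set (B k))) borel (\<lambda>b. expo \<xi> (inv_prod R k *v b)))"
      by (subst distr_digit) simp
    also have "\<dots> = (\<integral>b. expo \<xi> (inv_prod R k *v b) \<partial>measure_pmf (pmf_of_set (B k)))"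
      by (rule integral_distr) auto
    also have "\<dots> = (\<Sum>b\<in>B k. pmf (pmf_of_set (B k)) b *\<^sub>R expo \<xi> (inv_prod R k *v b))"
      using B_finite[OF k] by (intro integral_measure_pmf) auto
    also have "\<dots> = (\<Sum>b\<in>B k. expo \<xi> (inv_prod R k *v b)) / of_nat (card (B k))"
      using B_finite[OF k] by (simp add: pmf_of_set sum_divide_distrib scaleR_conv_of_real)
    finally show "(\<integral>\<omega>. expo \<xi> (inv_prod R k *v \<omega> k) \<partial>digit_space B) = \<dots>" .
  qed simp
  finally show ?thesis .
qed

lemma conv_fourier_tendsto: "(\<lambda>n. conv_fourier R B n \<xi>) \<longlonglongrightarrow> fourier (inf_conv R B) \<xi>"
proof -
  have "continuous_on UNIV (expo \<xi>)"
    by (intro continuous_intros)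
  from integral_digit_sum_tendsto[OF this, of 1] show ?thesis
    by (simp add: integral_expo_digit_sum fourier_def)
qed

text \<open>This is \<open>conv_fourier_add\<close> in the limit of large \<open>m\<close>.\<close>

lemma fourier_inf_conv_split:
  "fourier (inf_conv R B) \<xi> = conv_fourier R B n \<xi> *
     fourier (inf_conv (\<lambda>k. R (n + k)) (\<lambda>k. B (n + k))) (\<xi> v* inv_prod R n)"
proof (rule LIMSEQ_unique)
  interpret S: cube_seq "\<lambda>k. R (n + k)" "\<lambda>k. B (n + k)" t0
    by (rule cube_seq_shift)
  show "(\<lambda>m. conv_fourier R B (n + m) \<xi>) \<longlonglongrightarrow> fourier (inf_conv R B) \<xi>"
    using LIMSEQ_ignore_initial_segment[OF conv_fourier_tendsto, of n] by (simp add: add.commute)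
  show "(\<lambda>m. conv_fourier R B (n + m) \<xi>) \<longlonglongrightarrow> conv_fourier R B n \<xi> *
      fourier (inf_conv (\<lambda>k. R (n + k)) (\<lambda>k. B (n + k))) (\<xi> v* inv_prod R n)"
    unfolding conv_fourier_add by (intro tendsto_mult tendsto_const S.conv_fourier_tendsto)
qed

text \<open>The first digit is \<open>b\<close> with probability \<open>1 / card (B 1)\<close>, and
  then the limit lies in the first-level image of the cube. For the recurring pair this is the mass
  inside the open cube.\<close>

lemma inf_conv_first_digit:
  assumes b: "b \<in> B 1"
  shows "1 / real (card (B 1)) \<le> measure (inf_conv R B) ((\<lambda>x. matrix_inv (R 1) *v (x + b)) ` C)"
proof -
  interpret prob_space "digit_space B"
    by (rule prob_space_digit_space)
  define K where "K = (\<lambda>x. matrix_inv (R 1) *v (x + b)) ` C"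
  have "compact K"
    unfolding K_def
    by (intro compact_continuous_image continuous_intros compact_cbox
        bounded_linear.continuous_on[OF matrix_vector_mul_bounded_linear])
  then have K [measurable]: "K \<in> sets borel"
    by (simp add: compact_imp_closed)
  have fin: "finite (B 1)" "B 1 \<noteq> {}"
    using B_finite[of 1] by auto
  have "1 / real (card (B 1)) = measure (measure_pmf (pmf_of_set (B 1))) {b}"
    using b fin by (simp add: measure_pmf_single)
  also have "\<dots> = measure (distr (measure_pmf (pmf_of_set (B 1))) borel (\<lambda>x. x)) {b}"
    by (simp add: measure_distr)
  also have "\<dots> = measure (distr (digit_space B) borel (\<lambda>\<omega>. \<omega> 1)) {b}"
    using distr_digit[of B "\<lambda>x. x" 1] by simp
  also have "\<dots> = measure (digit_space B) ((\<lambda>\<omega>. \<omega> 1) -` {b} \<inter> space (digit_space B))"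
    by (rule measure_distr) (auto intro: measurable_digit)
  also have "\<dots> \<le> measure (digit_space B) ((\<lambda>\<omega>. lim (\<lambda>n. digit_sum R n \<omega>)) -` K \<inter> space (digit_space B))"
  proof (rule finite_measure_mono_AE)
    show "AE \<omega> in digit_space B. \<omega> \<in> (\<lambda>\<omega>. \<omega> 1) -` {b} \<inter> space (digit_space B) \<longrightarrow>
        \<omega> \<in> (\<lambda>\<omega>. lim (\<lambda>n. digit_sum R n \<omega>)) -` K \<inter> space (digit_space B)"
      using AE_digits
    proof eventually_elim
      case (elim \<omega>)
      then have "lim (\<lambda>n. digit_sum R n \<omega>) \<in> (\<lambda>y. digit_sum R 1 \<omega> + inv_prod R 1 *v y) ` C"
        by (intro digit_limit_in) auto
      moreover have "digit_sum R 1 \<omega> + inv_prod R 1 *v y = matrix_inv (R 1) *v (y + \<omega> 1)" for y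
        by (simp add: digit_sum_def matrix_vector_right_distrib)
      ultimately show ?case
        by (auto simp: K_def)
    qed
  qed measurable
  also have "\<dots> = measure (inf_conv R B) K"
    unfolding inf_conv_def by (rule measure_distr[symmetric]) auto
  finally show ?thesis
    by (simp add: K_def)
qed

end

section \<open>Spectrality\<close>

lemma fourier_minus: "fourier M (- \<xi>) = cnj (fourier M \<xi>)"
  by (simp add: fourier_def expo_minus_left flip: Bochner_Integration.integral_cnj)

lemma integral_expo_mult_cnj: "(\<integral>x. expo a x * cnj (expo b x) \<partial>M) = fourier M (a - b)"
  by (simp add: fourier_def expo_diff_left)

lemma borel_measurable_expo':
  fixes a :: "'a::euclidean_space"
  shows "borel_prob M \<Longrightarrow> expo a \<in> borel_measurable M"
  by (rule borel_prob_measurable[OF _ borel_measurable_expo])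

context
  fixes M :: "'a::euclidean_space measure" and \<Lambda> :: "'a set"
  assumes M: "borel_prob M"
    and orth: "\<And>l l'. l \<in> \<Lambda> \<Longrightarrow> l' \<in> \<Lambda> \<Longrightarrow> l \<noteq> l' \<Longrightarrow> fourier M (l - l') = 0"
begin

text \<open>\<open>g\<close> is what remains of \<open>expo \<xi>\<close> after orthogonal
  projection onto the span of the orthonormal exponentials in \<open>F\<close>; its squared norm
  follows from Pythagoras.\<close>

lemma expo_residual:
  fixes \<xi> :: 'a
  assumes F: "finite F" "F \<subseteq> \<Lambda>"
  defines "g \<equiv> \<lambda>x. expo \<xi> x - (\<Sum>l\<in>F. fourier M (\<xi> - l) * expo l x)"
  shows "integrable M (\<lambda>x. (cmod (g x))\<^sup>2)"
    and "(\<integral>x. (cmod (g x))\<^sup>2 \<partial>M) = 1 - (\<Sum>l\<in>F. (cmod (fourier M (\<xi> - l)))\<^sup>2)"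
    and "g \<in> borel_measurable M"
proof -
  define c where "c l = fourier M (\<xi> - l)" for l
  \<comment> \<open>Expanding the squared modulus into exponentials reduces its integral to values
    of the transform at differences of frequencies.\<close>
  define h where "h x = 1 - (\<Sum>l\<in>F. cnj (c l) * expo (\<xi> - l) x) - (\<Sum>l\<in>F. c l * expo (l - \<xi>) x)
      + (\<Sum>l\<in>F. \<Sum>m\<in>F. (c l * cnj (c m)) * expo (l - m) x)" for x
  have gh: "complex_of_real ((cmod (g x))\<^sup>2) = h x" for x
  proof -
    have "complex_of_real ((cmod (g x))\<^sup>2) = g x * cnj (g x)"
      by (rule complex_norm_square)
    also have "\<dots> = expo \<xi> x * cnj (expo \<xi> x) - (\<Sum>l\<in>F. cnj (c l) * (expo \<xi> x * cnj (expo l x)))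
        - (\<Sum>l\<in>F. c l * (expo l x * cnj (expo \<xi> x)))
        + (\<Sum>l\<in>F. c l * expo l x) * (\<Sum>m\<in>F. cnj (c m * expo m x))"
      by (simp add: g_def c_def algebra_simps sum_distrib_left sum_distrib_right)
    also have "(\<Sum>l\<in>F. c l * expo l x) * (\<Sum>m\<in>F. cnj (c m * expo m x)) =
        (\<Sum>l\<in>F. \<Sum>m\<in>F. (c l * cnj (c m)) * (expo l x * cnj (expo m x)))"
      by (simp add: sum_product mult_ac)
    also have "expo \<xi> x * cnj (expo \<xi> x) = 1"
      using complex_norm_square[of "expo \<xi> x"] by simp
    finally show ?thesis
      by (simp only: h_def expo_diff_left)
  qed
  have int: "integrable M (expo a)" for a
    by (rule integrable_expo[OF M])
  have hint: "integrable M h"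
    unfolding h_def using M int
    by (intro Bochner_Integration.integrable_add Bochner_Integration.integrable_diff
        Bochner_Integration.integrable_sum integrable_mult_right)
      (auto simp: borel_prob_def prob_space.finite_measure finite_measure.integrable_const)
  then have "integrable M (\<lambda>x. complex_of_real ((cmod (g x))\<^sup>2))"
    by (simp only: gh)
  then show sq: "integrable M (\<lambda>x. (cmod (g x))\<^sup>2)"
    by (simp only: complex_of_real_integrable_eq)
  have cc: "c l * fourier M (l - \<xi>) = complex_of_real ((cmod (c l))\<^sup>2)" for l
    using fourier_minus[of M "\<xi> - l"] unfolding c_def complex_norm_square by simp
  have cc': "cnj (c l) * fourier M (\<xi> - l) = complex_of_real ((cmod (c l))\<^sup>2)" for l
    unfolding c_def complex_norm_square by (rule mult.commute)
  have "complex_of_real (\<integral>x. (cmod (g x))\<^sup>2 \<partial>M) = (\<integral>x. h x \<partial>M)"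
    by (simp only: integral_complex_of_real[symmetric] gh)
  also have "\<dots> = 1 - (\<Sum>l\<in>F. cnj (c l) * fourier M (\<xi> - l)) - (\<Sum>l\<in>F. c l * fourier M (l - \<xi>))
      + (\<Sum>l\<in>F. \<Sum>m\<in>F. (c l * cnj (c m)) * fourier M (l - m))"
    unfolding h_def fourier_def using M int
    by (simp add: borel_prob_def prob_space.finite_measure finite_measure.integrable_const prob_space.prob_space)
  also have "(\<Sum>l\<in>F. \<Sum>m\<in>F. (c l * cnj (c m)) * fourier M (l - m)) =
      (\<Sum>l\<in>F. \<Sum>m\<in>F. if l = m then complex_of_real ((cmod (c l))\<^sup>2) else 0)"
    using F orth by (intro sum.cong refl) (auto simp: fourier_0[OF M] complex_norm_square simp del: of_real_power)
  also have "\<dots> = (\<Sum>l\<in>F. complex_of_real ((cmod (c l))\<^sup>2))"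
    using F by simp
  finally have "complex_of_real (\<integral>x. (cmod (g x))\<^sup>2 \<partial>M) = complex_of_real (1 - (\<Sum>l\<in>F. (cmod (c l))\<^sup>2))"
    by (simp add: cc cc')
  then show "(\<integral>x. (cmod (g x))\<^sup>2 \<partial>M) = 1 - (\<Sum>l\<in>F. (cmod (fourier M (\<xi> - l)))\<^sup>2)"
    unfolding of_real_eq_iff c_def .
  show "g \<in> borel_measurable M"
    unfolding g_def using borel_measurable_expo'[OF M]
    by (intro borel_measurable_diff borel_measurable_sum borel_measurable_times) auto
qed

text \<open>The residual of \<open>expo (- \<xi>)\<close> has nonnegative norm, and conjugation
  turns \<open>- \<xi> - l\<close> into \<open>\<xi> + l\<close>.\<close>

lemma Bessel_expo:
  assumes "finite F" "F \<subseteq> \<Lambda>"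
  shows "(\<Sum>l\<in>F. (cmod (fourier M (\<xi> + l)))\<^sup>2) \<le> 1"
proof -
  have "0 \<le> 1 - (\<Sum>l\<in>F. (cmod (fourier M (- \<xi> - l)))\<^sup>2)"
    unfolding expo_residual(2)[OF assms, symmetric] by simp
  moreover have "cmod (fourier M (- \<xi> - l)) = cmod (fourier M (\<xi> + l))" for l
    using fourier_minus[of M "\<xi> + l"] by simp
  ultimately show ?thesis
    by simp
qed

text \<open>By \<open>total\<close> the residual of every exponential can be made small in L^2. A
  function orthogonal to the exponentials of \<Lambda> is then orthogonal to all exponentials, hence
  zero.\<close>

lemma is_spectrumI:
  assumes C: "compact C" "AE x in M. x \<in> C" and \<Lambda>: "countable \<Lambda>"
    and total: "\<And>\<xi> e. e > 0 \<Longrightarrow> \<exists>F. finite F \<and> F \<subseteq> \<Lambda> \<and> 1 - e \<le> (\<Sum>l\<in>F. (cmod (fourier M (\<xi> + l)))\<^sup>2)"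
  shows "is_spectrum M \<Lambda>"
  unfolding is_spectrum_def
proof (intro conjI ballI allI impI)
  show "countable \<Lambda>"
    by (rule \<Lambda>)
  show "(\<integral>x. expo l x * cnj (expo l' x) \<partial>M) = (if l = l' then 1 else 0)" if "l \<in> \<Lambda>" "l' \<in> \<Lambda>" for l l'
    using orth[OF that] by (auto simp: integral_expo_mult_cnj fourier_0[OF M])
  fix f :: "'a \<Rightarrow> complex"
  assume "f \<in> borel_measurable M \<and> integrable M (\<lambda>x. (cmod (f x))\<^sup>2) \<and>
      (\<forall>l\<in>\<Lambda>. (\<integral>x. f x * cnj (expo l x) \<partial>M) = 0)"
  then have f [measurable]: "f \<in> borel_measurable M" and f2: "integrable M (\<lambda>x. (cmod (f x))\<^sup>2)"
    and f0: "\<And>l. l \<in> \<Lambda> \<Longrightarrow> (\<integral>x. f x * cnj (expo l x) \<partial>M) = 0"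
    by auto
  interpret prob_space M
    using M by (simp add: borel_prob_def)
  have fint: "integrable M f"
    by (rule square_integrable_imp_integrable[OF f]) (use f2 in \<open>simp add: norm_power integrable_iff_bounded\<close>)
  have fe: "integrable M (\<lambda>x. f x * cnj (expo a x))" for a
    unfolding expo_minus_left[symmetric]
    by (rule integrable_mult_bounded[OF fint borel_measurable_expo'[OF M], where W = 1]) simp
  define I where "I = (\<integral>x. (cmod (f x))\<^sup>2 \<partial>M)"
  have "I \<ge> 0"
    by (simp add: I_def)
  have "(\<integral>x. f x * cnj (expo \<xi> x) \<partial>M) = 0" for \<xi>
  proof -
    have "cmod (\<integral>x. f x * cnj (expo \<xi> x) \<partial>M) \<le> 0 + \<delta>" if \<delta>: "\<delta> > 0" for \<delta>
    proof -
      \<comment> \<open>\<open>s\<close> is the weight in Young's inequality below, which acts as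
        Cauchy-Schwarz: \<open>s * I\<close> is at most \<delta>, and a residual of at most
        \<open>s * \<delta>\<close> makes the other term at most \<delta> as well.\<close>
      define s where "s = \<delta> / (I + 1)"
      have s: "s > 0" "s * I \<le> \<delta>"
        using \<delta> \<open>I \<ge> 0\<close> by (auto simp: s_def field_simps)
      \<comment> \<open>The residual involves the frequencies \<open>\<xi> - l\<close>, whose
        transforms have the same moduli as those at \<open>- \<xi> + l\<close>.\<close>
      obtain F where F: "finite F" "F \<subseteq> \<Lambda>" and F1: "1 - s * \<delta> \<le> (\<Sum>l\<in>F. (cmod (fourier M (- \<xi> + l)))\<^sup>2)"
        using total[of "s * \<delta>" "- \<xi>"] s \<delta> by auto
      define g where "g x = expo \<xi> x - (\<Sum>l\<in>F. fourier M (\<xi> - l) * expo l x)" for x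
      note g = expo_residual[OF F, where \<xi> = \<xi>, folded g_def]
      have "cmod (fourier M (- \<xi> + l)) = cmod (fourier M (\<xi> - l))" for l
        using fourier_minus[of M "\<xi> - l"] by simp
      with F1 g(2) have gs: "(\<integral>x. (cmod (g x))\<^sup>2 \<partial>M) \<le> s * \<delta>"
        by simp
      have "f x * cnj (g x) = f x * cnj (expo \<xi> x) - (\<Sum>l\<in>F. cnj (fourier M (\<xi> - l)) * (f x * cnj (expo l x)))" for x
        by (simp add: g_def right_diff_distrib sum_distrib_left mult_ac)
      then have eq: "(\<integral>x. f x * cnj (g x) \<partial>M) = (\<integral>x. f x * cnj (expo \<xi> x) \<partial>M)"
        using fe f0 F by (simp add: subset_eq)
      have young: "cmod (f x * cnj (g x)) \<le> (s * (cmod (f x))\<^sup>2 + (cmod (g x))\<^sup>2 / s) / 2" for x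
      proof -
        have "0 \<le> (s * cmod (f x) - cmod (g x))\<^sup>2 / s"
          using s by simp
        also have "\<dots> = s * (cmod (f x))\<^sup>2 + (cmod (g x))\<^sup>2 / s - 2 * (cmod (f x) * cmod (g x))"
          using s by (simp add: power2_eq_square field_simps)
        finally show ?thesis
          by (simp add: norm_mult)
      qed
      have "cmod (\<integral>x. f x * cnj (g x) \<partial>M) \<le> (\<integral>x. cmod (f x * cnj (g x)) \<partial>M)"
        by (rule integral_norm_bound)
      also have "\<dots> \<le> (\<integral>x. (s * (cmod (f x))\<^sup>2 + (cmod (g x))\<^sup>2 / s) / 2 \<partial>M)"
      proof (rule integral_mono')
        show "integrable M (\<lambda>x. (s * (cmod (f x))\<^sup>2 + (cmod (g x))\<^sup>2 / s) / 2)"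
          using f2 g(1) by simp
      qed (use young s in auto)
      also have "\<dots> = (s * I + (\<integral>x. (cmod (g x))\<^sup>2 \<partial>M) / s) / 2"
        using f2 g(1) by (simp add: I_def)
      also have "\<dots> \<le> (\<delta> + (s * \<delta>) / s) / 2"
        using s gs by (intro divide_right_mono add_mono) auto
      also have "\<dots> = \<delta>"
        using s by simp
      finally show ?thesis
        by (simp add: eq)
    qed
    then have "cmod (\<integral>x. f x * cnj (expo \<xi> x) \<partial>M) \<le> 0"
      by (rule field_le_epsilon)
    then show ?thesis
      by simp
  qed
  then show "AE x in M. f x = 0"
    by (rule AE_zero_if_fourier_zero[OF M C fint])
qed

end

section \<open>Growing a spectrum along the recurring levels\<close>

context cube_seq
begin

abbreviation "tail n \<equiv> inf_conv (\<lambda>k. R (n + k)) (\<lambda>k. B (n + k))"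

lemma borel_prob_tail: "borel_prob (tail n)"
  and AE_tail: "AE x in tail n. x \<in> C"
proof -
  interpret S: cube_seq "\<lambda>k. R (n + k)" "\<lambda>k. B (n + k)" t0
    by (rule cube_seq_shift)
  show "borel_prob (tail n)" "AE x in tail n. x \<in> C"
    by (rule S.borel_prob_inf_conv, rule S.AE_inf_conv)
qed

text \<open>All tails live on the same cube, so the constant is uniform in \<open>n\<close>.\<close>

lemma fourier_tail_Lipschitz:
  obtains c where "c > 0" "\<And>n a b. cmod (fourier (tail n) a - fourier (tail n) b) \<le> c * norm (a - b)"
proof -
  obtain \<rho> where \<rho>: "\<rho> > 0" "\<And>y. y \<in> C \<Longrightarrow> norm y \<le> \<rho>"
    using bounded_cbox[of t0 "t0 + One"] unfolding bounded_pos by blast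
  have "AE x in tail n. norm x \<le> \<rho>" for n
    using AE_tail[of n] by eventually_elim (rule \<rho>(2))
  then have "cmod (fourier (tail n) a - fourier (tail n) b) \<le> (2 * pi * \<rho>) * norm (a - b)" for n a b
    by (rule fourier_Lipschitz[OF borel_prob_tail])
  then show ?thesis
    using that[of "2 * pi * \<rho>"] \<rho>(1) by simp
qed

context
  fixes e :: real and N0 :: "nat set"
  assumes e: "e > 0" "e \<le> 1 / 2" and N0: "infinite N0"
    and pos: "\<And>n x. n \<in> N0 \<Longrightarrow> \<exists>k\<in>int_lattice. e \<le> cmod (fourier (tail n) (x + k))"
begin

text \<open>The second condition bounds the tail factor from below at every chosen frequency; it
  lets the finite-level transforms be dominated by that of the infinite convolution.\<close>

definition adapted :: "nat \<Rightarrow> (real ^ 'd) set \<Rightarrow> bool" where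
  "adapted n \<Lambda> \<longleftrightarrow> partial_spectrum R B n \<Lambda> \<and> (\<forall>l\<in>\<Lambda>. e \<le> cmod (fourier (tail n) (l v* inv_prod R n)))"

text \<open>A level in \<open>N0\<close> is taken so late that the old frequencies, rescaled, are
  near 0, where the transform of the tail is near 1. The new elements are moved by the period
  lattice until they satisfy the bound.\<close>

lemma adapted_extend:
  assumes \<Lambda>: "adapted n \<Lambda>"
  shows "\<exists>n' \<Lambda>'. adapted n' \<Lambda>' \<and> n < n' \<and> \<Lambda> \<subseteq> \<Lambda>'"
proof -
  obtain c where c: "c > 0" "\<And>n a b. cmod (fourier (tail n) a - fourier (tail n) b) \<le> c * norm (a - b)"
    using fourier_tail_Lipschitz by blast
  have ps: "partial_spectrum R B n \<Lambda>" and fin: "finite \<Lambda>"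
    using \<Lambda> by (auto simp: adapted_def partial_spectrum_def)
  have "\<forall>\<^sub>F m in sequentially. \<forall>l\<in>\<Lambda>. norm (l v* inv_prod R m) < 1 / (2 * c)"
    using fin c(1) tendstoD[OF inv_prod_tendsto_0(2)] by (intro eventually_ball_finite) auto
  \<comment> \<open>Within \<open>1 / (2 * c)\<close> of 0 the transform of a tail differs from 1 by
    at most \<open>1 / 2\<close>, which leaves at least \<open>1 / 2 \<ge> e\<close>.\<close>
  then obtain N where N: "\<And>m l. m \<ge> N \<Longrightarrow> l \<in> \<Lambda> \<Longrightarrow> norm (l v* inv_prod R m) < 1 / (2 * c)"
    unfolding eventually_sequentially by blast
  obtain n' where n': "n' \<in> N0" "n' > max n N"
    using N0 unfolding infinite_nat_iff_unbounded by blast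
  define m where "m = n' - n"
  have nm: "n' = n + m"
    using n' by (simp add: m_def)
  interpret S: admissible_seq "\<lambda>k. R (n + k)" "\<lambda>k. B (n + k)"
    by (rule shift)
  obtain D where D: "partial_spectrum (\<lambda>k. R (n + k)) (\<lambda>k. B (n + k)) m D" "0 \<in> D"
    using S.partial_spectrum_exists by blast
  define x where "x l d = (l + d v* mat_prod_rev R n) v* inv_prod R n'" for l d
  define k where "k l d = (SOME k. k \<in> int_lattice \<and> e \<le> cmod (fourier (tail n') (x l d + k)))" for l d
  have k: "k l d \<in> int_lattice" "e \<le> cmod (fourier (tail n') (x l d + k l d))" for l d
    using someI_ex[OF pos[OF n'(1), of "x l d", unfolded Bex_def], folded k_def] by auto
  \<comment> \<open>The pair with \<open>d = 0\<close> reproduces the old element \<open>l\<close>,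
    which must not move if the spectra are to increase.\<close>
  define \<kappa> where "\<kappa> l d = (if d = 0 then 0 else k l d)" for l d
  define G where "G = (\<lambda>(l, d). l + d v* mat_prod_rev R n + \<kappa> l d v* mat_prod_rev R (n + m))"
  have "partial_spectrum R B (n + m) (G ` (\<Lambda> \<times> D))"
    unfolding G_def by (rule partial_spectrum_extend[OF ps D(1)]) (simp add: \<kappa>_def k int_lattice_closed)
  moreover have "e \<le> cmod (fourier (tail n') (G (l, d) v* inv_prod R n'))" if l: "l \<in> \<Lambda>" for l d
  proof (cases "d = 0")
    case True
    have "cmod (fourier (tail n') (l v* inv_prod R n') - fourier (tail n') 0) \<le> c * norm (l v* inv_prod R n')"
      using c(2)[of n' "l v* inv_prod R n'" 0] by simp
    also have "\<dots> \<le> 1 / 2"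
      using N[of n' l] n' l c(1) by (simp add: field_simps)
    finally have "cmod (1 - fourier (tail n') (l v* inv_prod R n')) \<le> 1 / 2"
      by (simp add: fourier_0[OF borel_prob_tail] norm_minus_commute)
    moreover have "1 \<le> cmod (1 - fourier (tail n') (l v* inv_prod R n')) + cmod (fourier (tail n') (l v* inv_prod R n'))"
      using norm_triangle_ineq[of "1 - fourier (tail n') (l v* inv_prod R n')" "fourier (tail n') (l v* inv_prod R n')"]
      by simp
    ultimately show ?thesis
      using True e(2) by (simp add: G_def \<kappa>_def)
  next
    case False
    have "G (l, d) v* inv_prod R n' = x l d + k l d"
      using False by (simp add: G_def \<kappa>_def x_def vector_matrix_add_distrib vector_matrix_mul_assoc inv_prod_mult flip: nm)
    then show ?thesis
      using k(2) by simp
  qed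
  ultimately have "adapted n' (G ` (\<Lambda> \<times> D))"
    unfolding adapted_def nm by auto
  moreover have "\<Lambda> \<subseteq> G ` (\<Lambda> \<times> D)"
  proof
    fix l assume "l \<in> \<Lambda>"
    then show "l \<in> G ` (\<Lambda> \<times> D)"
      using D(2) by (intro image_eqI[of _ _ "(l, 0)"]) (auto simp: G_def \<kappa>_def)
  qed
  moreover have "n < n'"
    using n' by simp
  ultimately show ?thesis
    by blast
qed

text \<open>The spectrum is the union of an increasing sequence of adapted sets. Domination prevents
  the Parseval sum from losing mass in the limit.\<close>

lemma is_spectrum_inf_conv: "\<exists>\<Lambda>. \<Lambda> \<subseteq> int_lattice \<and> is_spectrum (inf_conv R B) \<Lambda>"
proof -
  let ?\<mu> = "inf_conv R B"
  obtain c where c: "c > 0" "\<And>n a b. cmod (fourier (tail n) a - fourier (tail n) b) \<le> c * norm (a - b)"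
    using fourier_tail_Lipschitz by blast
  have start: "adapted 0 {0}"
    using e fourier_0[OF borel_prob_tail[of 0]]
    by (simp add: adapted_def partial_spectrum_def conv_fourier_def int_lattice_closed)
  have "\<exists>s. \<forall>j. adapted (fst (s j)) (snd (s j)) \<and> (fst (s j) < fst (s (Suc j)) \<and> snd (s j) \<subseteq> snd (s (Suc j)))"
  proof (intro dependent_nat_choice)
    show "\<exists>x. adapted (fst x) (snd x)"
      using start by (intro exI[of _ "(0, {0})"]) simp
    show "\<exists>y. adapted (fst y) (snd y) \<and> fst x < fst y \<and> snd x \<subseteq> snd y" if x: "adapted (fst x) (snd x)" for x
    proof -
      obtain n' \<Lambda>' where "adapted n' \<Lambda>' \<and> fst x < n' \<and> snd x \<subseteq> \<Lambda>'"
        using adapted_extend[OF x] by blast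
      then show ?thesis
        by (intro exI[of _ "(n', \<Lambda>')"]) simp
    qed
  qed
  then obtain s where s: "\<And>j. adapted (fst (s j)) (snd (s j))" "\<And>j. fst (s j) < fst (s (Suc j))" "\<And>j. snd (s j) \<subseteq> snd (s (Suc j))"
    by blast
  define n \<Lambda>j where "n = fst \<circ> s" and "\<Lambda>j = snd \<circ> s"
  have ps: "partial_spectrum R B (n j) (\<Lambda>j j)" for j
    using s(1) by (simp add: adapted_def n_def \<Lambda>j_def)
  have low: "e \<le> cmod (fourier (tail (n j)) (l v* inv_prod R (n j)))" if "l \<in> \<Lambda>j j" for j l
    using s(1)[of j] that by (auto simp: adapted_def n_def \<Lambda>j_def)
  have n_lim: "filterlim n sequentially sequentially"
    using s(2) by (intro filterlim_subseq) (simp add: strict_mono_Suc_iff n_def)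
  have mono: "\<Lambda>j i \<subseteq> \<Lambda>j j" if "i \<le> j" for i j
    by (rule lift_Suc_mono_le[OF _ that]) (simp add: \<Lambda>j_def s(3))
  have fin: "finite (\<Lambda>j j)" and lat: "\<Lambda>j j \<subseteq> int_lattice"
    and one: "(\<Sum>l\<in>\<Lambda>j j. (cmod (conv_fourier R B (n j) (\<xi> + l)))\<^sup>2) = 1" for j \<xi>
    using ps[of j] by (auto simp: partial_spectrum_def)
  define \<Lambda> where "\<Lambda> = (\<Union>j. \<Lambda>j j)"
  have orth: "fourier ?\<mu> (l - l') = 0" if l: "l \<in> \<Lambda>" and l': "l' \<in> \<Lambda>" and ne: "l \<noteq> l'" for l l'
  proof -
    obtain i j where "l \<in> \<Lambda>j i" "l' \<in> \<Lambda>j j"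
      using l l' by (auto simp: \<Lambda>_def)
    then have "l \<in> \<Lambda>j (max i j)" "l' \<in> \<Lambda>j (max i j)"
      using mono[of i "max i j"] mono[of j "max i j"] by auto
    then have "conv_fourier R B (n (max i j)) (l - l') = 0"
      using ne by (intro partial_spectrum_orthogonal[OF ps])
    then show ?thesis
      by (subst fourier_inf_conv_split[of _ "n (max i j)"]) simp
  qed
  have "\<exists>F. finite F \<and> F \<subseteq> \<Lambda> \<and> 1 - \<delta> \<le> (\<Sum>l\<in>F. (cmod (fourier ?\<mu> (\<xi> + l)))\<^sup>2)"
    if \<delta>: "\<delta> > 0" for \<xi> \<delta>
  proof -
    define a where "a l = (cmod (fourier ?\<mu> (\<xi> + l)))\<^sup>2" for l
    \<comment> \<open>The tail factor at \<open>\<xi> + l\<close> will be at least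
      \<open>e / 2\<close>; \<open>q\<close> is the inverse square of that.\<close>
    define q where "q = 4 / e\<^sup>2"
    have q: "q > 0"
      using e by (simp add: q_def)
    \<comment> \<open>The error is \<eta> from the terms in \<open>F\<close> and
      \<open>q * \<eta>\<close> from the remaining ones, together \<delta>.\<close>
    define \<eta> where "\<eta> = \<delta> / (1 + q)"
    have "\<eta> * (1 + q) = \<delta>"
      using q by (simp add: \<eta>_def)
    then have \<eta>: "\<eta> + q * \<eta> = \<delta>" "\<eta> > 0"
      using \<delta> q by (simp add: algebra_simps, simp add: \<eta>_def)
    \<comment> \<open>Bessel's inequality makes the supremum finite; a finite \<open>F\<close>
      within \<eta> of it leaves at most \<eta> for any finite set of further frequencies.\<close>
    let ?X = "sum a ` {F. finite F \<and> F \<subseteq> \<Lambda>}"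
    have bdd: "bdd_above ?X"
      unfolding bdd_above_def a_def
      using Bessel_expo[OF borel_prob_inf_conv orth] by blast
    have ne: "?X \<noteq> {}"
      by auto
    obtain F where F: "finite F" "F \<subseteq> \<Lambda>" "Sup ?X - \<eta> < sum a F"
      using less_cSup_iff[OF ne bdd, of "Sup ?X - \<eta>"] \<eta>(2) by auto
    have "\<forall>\<^sub>F j in sequentially. \<forall>l\<in>F. l \<in> \<Lambda>j j"
    proof (intro eventually_ball_finite ballI F(1))
      fix l assume "l \<in> F"
      then obtain i where i: "l \<in> \<Lambda>j i"
        using F(2) by (auto simp: \<Lambda>_def)
      show "\<forall>\<^sub>F j in sequentially. l \<in> \<Lambda>j j"
        using eventually_ge_at_top[of i] by eventually_elim (use i mono in blast)
    qed
    moreover have "\<forall>\<^sub>F j in sequentially. (\<Sum>l\<in>F. (cmod (conv_fourier R B (n j) (\<xi> + l)))\<^sup>2) < sum a F + \<eta>"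
    proof (rule order_tendstoD)
      show "(\<lambda>j. \<Sum>l\<in>F. (cmod (conv_fourier R B (n j) (\<xi> + l)))\<^sup>2) \<longlonglongrightarrow> sum a F"
        unfolding a_def
        by (intro tendsto_intros filterlim_compose[OF conv_fourier_tendsto n_lim])
    qed (use \<eta> in simp)
    \<comment> \<open>A rescaled \<xi> shorter than \<open>e / (2 * c)\<close> costs at most half of
      the lower bound \<open>e\<close>.\<close>
    moreover have "\<forall>\<^sub>F j in sequentially. norm (\<xi> v* inv_prod R (n j)) < e / (2 * c)"
      using tendstoD[OF filterlim_compose[OF inv_prod_tendsto_0(2) n_lim], of "e / (2 * c)" \<xi>] e c by simp
    ultimately have "\<forall>\<^sub>F j in sequentially. (\<forall>l\<in>F. l \<in> \<Lambda>j j) \<and>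
        (\<Sum>l\<in>F. (cmod (conv_fourier R B (n j) (\<xi> + l)))\<^sup>2) < sum a F + \<eta> \<and>
        norm (\<xi> v* inv_prod R (n j)) < e / (2 * c)"
      by eventually_elim auto
    then obtain j where j: "F \<subseteq> \<Lambda>j j" "(\<Sum>l\<in>F. (cmod (conv_fourier R B (n j) (\<xi> + l)))\<^sup>2) < sum a F + \<eta>"
        "norm (\<xi> v* inv_prod R (n j)) < e / (2 * c)"
      using eventually_happens'[OF sequentially_bot] by blast
    have dom: "(cmod (conv_fourier R B (n j) (\<xi> + l)))\<^sup>2 \<le> q * a l" if l: "l \<in> \<Lambda>j j" for l
    proof -
      let ?f = "fourier (tail (n j))" and ?A = "inv_prod R (n j)"
      have "(\<xi> + l) v* ?A - l v* ?A = \<xi> v* ?A"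
        by (simp add: vector_matrix_add_distrib)
      then have "cmod (?f ((\<xi> + l) v* ?A) - ?f (l v* ?A)) \<le> c * norm (\<xi> v* ?A)"
        using c(2)[of "n j" "(\<xi> + l) v* ?A" "l v* ?A"] by simp
      also have "\<dots> \<le> e / 2"
        using j(3) c(1) by (simp add: field_simps)
      finally have "e / 2 \<le> cmod (?f ((\<xi> + l) v* ?A))"
        using low[OF l] norm_triangle_ineq2[of "?f (l v* ?A)" "?f (l v* ?A) - ?f ((\<xi> + l) v* ?A)"]
        by (simp add: norm_minus_commute)
      then have "(e / 2)\<^sup>2 \<le> (cmod (?f ((\<xi> + l) v* ?A)))\<^sup>2"
        using e by (intro power_mono) auto
      then have "1 \<le> q * (cmod (?f ((\<xi> + l) v* ?A)))\<^sup>2"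
        using e by (simp add: q_def power_divide field_simps)
      then have "(cmod (conv_fourier R B (n j) (\<xi> + l)))\<^sup>2 * 1 \<le>
          (cmod (conv_fourier R B (n j) (\<xi> + l)))\<^sup>2 * (q * (cmod (?f ((\<xi> + l) v* ?A)))\<^sup>2)"
        by (intro mult_left_mono) auto
      also have "\<dots> = q * a l"
        unfolding a_def by (subst fourier_inf_conv_split[of _ "n j"]) (simp add: norm_mult power_mult_distrib)
      finally show ?thesis
        by simp
    qed
    have "\<Lambda>j j \<subseteq> \<Lambda>"
      by (auto simp: \<Lambda>_def)
    then have "sum a (\<Lambda>j j) \<le> Sup ?X"
      using fin by (intro cSup_upper[OF _ bdd]) auto
    then have rest: "sum a (\<Lambda>j j - F) \<le> \<eta>"
      using F(3) sum_diff[OF fin j(1), of a] by linarith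
    have "1 = (\<Sum>l\<in>\<Lambda>j j - F. (cmod (conv_fourier R B (n j) (\<xi> + l)))\<^sup>2) + (\<Sum>l\<in>F. (cmod (conv_fourier R B (n j) (\<xi> + l)))\<^sup>2)"
      by (subst one[of j \<xi>, symmetric]) (rule sum.subset_diff[OF j(1) fin])
    also have "\<dots> \<le> (\<Sum>l\<in>\<Lambda>j j - F. q * a l) + (sum a F + \<eta>)"
      using j(2) by (intro add_mono sum_mono dom) auto
    also have "\<dots> = q * sum a (\<Lambda>j j - F) + (sum a F + \<eta>)"
      by (simp add: sum_distrib_left)
    also have "\<dots> \<le> q * \<eta> + (sum a F + \<eta>)"
      using rest q by simp
    finally have "1 - \<delta> \<le> sum a F"
      using \<eta>(1) by simp
    then show ?thesis
      using F(1,2) unfolding a_def by blast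
  qed
  moreover have "countable \<Lambda>"
    unfolding \<Lambda>_def using fin by (intro countable_UN) (auto intro: countable_finite)
  ultimately have "is_spectrum ?\<mu> \<Lambda>"
    by (intro is_spectrumI[OF borel_prob_inf_conv orth compact_cbox AE_inf_conv])
  moreover have "\<Lambda> \<subseteq> int_lattice"
    using lat by (auto simp: \<Lambda>_def)
  ultimately show ?thesis
    by blast
qed

end

end

section \<open>The lower bound from the recurring pair, and the conclusion\<close>

theorem theorem1p5:
  fixes R :: "nat \<Rightarrow> real ^ 'd ^ 'd" and B :: "nat \<Rightarrow> (real ^ 'd) set" and t0 :: "real ^ 'd"
  assumes adm: "\<And>n. n \<ge> 1 \<Longrightarrow> admissible_pair (R n) (B n)"
    and lim: "(\<lambda>n. norm (inv_prod R n)) \<longlonglongrightarrow> 0"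
    and cube_inv: "\<And>n b. n \<ge> 1 \<Longrightarrow> b \<in> B n \<Longrightarrow>
           (\<lambda>x. matrix_inv (R n) *v (x + b)) ` cbox t0 (t0 + One) \<subseteq> cbox t0 (t0 + One)"
    and recur: "\<exists>R0 B0 b0. admissible_pair R0 B0 \<and>
           infinite {n. n \<ge> 1 \<and> R n = R0 \<and> B n = B0} \<and> b0 \<in> B0 \<and>
           (\<lambda>x. matrix_inv R0 *v (x + b0)) ` cbox t0 (t0 + One) \<subseteq> interior (cbox t0 (t0 + One))"
  shows "\<exists>\<mu>. borel_prob \<mu> \<and> weak_conv_to (conv_partial R B) \<mu> \<and>
             spectral_measure \<mu> \<and>
             (\<exists>\<Lambda>. \<Lambda> \<subseteq> int_lattice \<and> is_spectrum \<mu> \<Lambda>)"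
proof -
  interpret cube_seq R B t0
    using adm lim cube_inv by unfold_locales
  obtain R0 B0 b0 where adm0: "admissible_pair R0 B0"
    and inf: "infinite {n. n \<ge> 1 \<and> R n = R0 \<and> B n = B0}" and b0: "b0 \<in> B0"
    and int: "(\<lambda>x. matrix_inv R0 *v (x + b0)) ` C \<subseteq> interior C"
    using recur by blast
  define K where "K = (\<lambda>x. matrix_inv R0 *v (x + b0)) ` C"
  have K: "compact K"
    unfolding K_def
    by (intro compact_continuous_image continuous_intros compact_cbox
        bounded_linear.continuous_on[OF matrix_vector_mul_bounded_linear])
  have "card B0 > 0"
    using adm0 by (simp add: admissible_pair_def card_gt_0_iff)
  then obtain e where e: "e > 0" and epos: "\<And>M x. borel_prob M \<Longrightarrow> AE y in M. y \<in> C \<Longrightarrow>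
      measure M K \<ge> 1 / real (card B0) \<Longrightarrow> \<exists>k\<in>int_lattice. e \<le> cmod (fourier M (x + k))"
    using equi_positive[OF K int[folded K_def], of "1 / real (card B0)"] by auto
  \<comment> \<open>The index is shifted by one because the first pair of \<open>tail n\<close> is
    the one at \<open>n + 1\<close>.\<close>
  define N0 where "N0 = {n. R (n + 1) = R0 \<and> B (n + 1) = B0}"
  have "{n. n \<ge> 1 \<and> R n = R0 \<and> B n = B0} \<subseteq> Suc ` N0"
  proof
    fix n assume "n \<in> {n. n \<ge> 1 \<and> R n = R0 \<and> B n = B0}"
    then show "n \<in> Suc ` N0"
      by (intro image_eqI[of _ _ "n - 1"]) (auto simp: N0_def)
  qed
  with inf have "infinite N0"
    using finite_subset by blast
  \<comment> \<open>The cap at \<open>1 / 2\<close> is what lets old frequencies keep the bound in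
    \<open>adapted_extend\<close>.\<close>
  moreover have "\<exists>k\<in>int_lattice. min e (1 / 2) \<le> cmod (fourier (tail n) (x + k))" if n: "n \<in> N0" for n x
  proof -
    interpret S: cube_seq "\<lambda>k. R (n + k)" "\<lambda>k. B (n + k)" t0
      by (rule cube_seq_shift)
    have "measure (tail n) K \<ge> 1 / real (card B0)"
      using S.inf_conv_first_digit[of b0] n b0 by (simp add: N0_def K_def)
    from epos[OF borel_prob_tail AE_tail this, of x] show ?thesis
      by (auto intro: min.coboundedI1)
  qed
  ultimately have "\<exists>\<Lambda>. \<Lambda> \<subseteq> int_lattice \<and> is_spectrum (inf_conv R B) \<Lambda>"
    using e by (intro is_spectrum_inf_conv[where e = "min e (1 / 2)" and ?N0.0 = N0]) auto
  then show ?thesis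
    using borel_prob_inf_conv weak_conv_inf_conv
    by (intro exI[of _ "inf_conv R B"]) (auto simp: spectral_measure_def)
qed

end
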